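(* Let $(B,\diamond,(\cdot,\cdot))$ be a finite-dimensional quadratic right Novikov algebra over $\mathbf{k}$. Let $A$ be a finite-dimensional vector space, let $(A,\circ)$ and $(A^*,\bullet)$ be Novikov algebras, and let $A\otimes B$ and $A^*\otimes B$ be the induced Lie algebras. If $(A\oplus A^*,A,A^* )$ is a Manin triple of Novikov algebras, then $(L=(A\oplus A^* )\otimes B,\ A\otimes B,\ A^*\otimes B)$, with $L$ the induced Lie algebra of the Novikov algebra $A\oplus A^*$ and $B$, is a Manin triple of Lie algebras associated with the bilinear form $$(a_1\otimes b_1+f\otimes b_2,\ a_2\otimes b_3+g\otimes b_4)_L=\langle f,a_2\rangle(b_2,b_3)+\langle g,a_1\rangle(b_1,b_4)$$ for all $a_1,a_2\in A$, $f,g\in A^*$, $b_1,b_2,b_3,b_4\in B$ (extended bilinearly).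
   Context: $\mathbf{k}$ is a field of characteristic zero. A Novikov algebra $(A,\circ)$: $(a\circ b)\circ c-a\circ(b\circ c)=(b\circ a)\circ c-b\circ(a\circ c)$ and $(a\circ b)\circ c=(a\circ c)\circ b$. A right Novikov algebra $(B,\diamond)$: $(a\diamond b)\diamond c-a\diamond(b\diamond c)=(a\diamond c)\diamond b-a\diamond(c\diamond b)$ and $a\diamond(b\diamond c)=b\diamond(a\diamond c)$. It is quadratic if equipped with a symmetric nondegenerate bilinear form with $(a\diamond b,c)=-(a,b\diamond c+c\diamond b)$. The induced Lie algebra of a Novikov algebra $(A,\circ)$ and a right Novikov algebra $(B,\diamond)$ is $A\otimes B$ with $[a_1\otimes b_1,a_2\otimes b_2]=a_1\circ a_2\otimes b_1\diamond b_2-a_2\circ a_1\otimes b_2\diamond b_1$. A Manin triple of Novikov algebras $(A\oplus A^*,A,A^* )$ is a Novikov algebra structure (product by juxtaposition) on the vector space $A\oplus A^*$ containing $(A,\circ)$ and $(A^*,\bullet)$ as subalgebras, such that $\mathcal{B}(a+f,b+g)=\langle f,b\rangle+\langle g,a\rangle$ satisfies $\mathcal{B}(xy,z)=-\mathcal{B}(y,xz+zx)$ for all $x,y,z\in A\oplus A^*$. A Manin triple of Lie algebras $(L,L_1,L_2)$ associated with a bilinear form $(\cdot,\cdot)_L$: the form on the Lie algebra $L$ is nondegenerate, symmetric and invariant ($([a,b],c)_L=(a,[b,c])_L$), $L_1,L_2$ are Lie subalgebras with $L=L_1\oplus L_2$ as vector spaces, and $(L_i,L_i)_L=0$ for $i=1,2$.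 *)

theory Defs
  imports "HOL-Analysis.Product_Vector" "HOL-Library.Function_Algebras"
begin

section \<open>Linear algebra on subspaces\<close>

text \<open>
  A vector space over a field \<open>'k\<close> is given by a scalar multiplication \<open>s\<close> on an ambient type
  together with a subspace \<open>V\<close> of that type; maps matter only on the subspace.
  The ambient type of a dual space or of a tensor product is a function type, on which
  \<open>Function_Algebras\<close> provides the pointwise addition and the following is the scalar
  multiplication.
\<close>

definition fun_scale :: "'k::field \<Rightarrow> ('x \<Rightarrow> 'k) \<Rightarrow> ('x \<Rightarrow> 'k)" where
  "fun_scale c f = (\<lambda>x. c * f x)"

definition linear_on ::
  "('k::field \<Rightarrow> 'v::ab_group_add \<Rightarrow> 'v) \<Rightarrow> 'v set \<Rightarrow> ('k \<Rightarrow> 'u::ab_group_add \<Rightarrow> 'u) \<Rightarrow> ('v \<Rightarrow> 'u) \<Rightarrow> bool"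
where
  "linear_on s1 V s2 h \<longleftrightarrow>
     (\<forall>x\<in>V. \<forall>x'\<in>V. h (x + x') = h x + h x') \<and> (\<forall>c. \<forall>x\<in>V. h (s1 c x) = s2 c (h x))"

definition bilinear_on ::
  "('k::field \<Rightarrow> 'v::ab_group_add \<Rightarrow> 'v) \<Rightarrow> 'v set \<Rightarrow> ('k \<Rightarrow> 'w::ab_group_add \<Rightarrow> 'w) \<Rightarrow> 'w set \<Rightarrow>
   ('k \<Rightarrow> 'u::ab_group_add \<Rightarrow> 'u) \<Rightarrow> ('v \<Rightarrow> 'w \<Rightarrow> 'u) \<Rightarrow> bool"
where
  "bilinear_on s1 V s2 W s3 h \<longleftrightarrow>
     (\<forall>y\<in>W. linear_on s1 V s3 (\<lambda>x. h x y)) \<and> (\<forall>x\<in>V. linear_on s2 W s3 (h x))"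

definition bilinear_form_on ::
  "('k::field \<Rightarrow> 'v::ab_group_add \<Rightarrow> 'v) \<Rightarrow> 'v set \<Rightarrow> ('v \<Rightarrow> 'v \<Rightarrow> 'k) \<Rightarrow> bool"
where
  "bilinear_form_on s V form \<longleftrightarrow> bilinear_on s V s V (*) form"

definition symmetric_on :: "'v set \<Rightarrow> ('v \<Rightarrow> 'v \<Rightarrow> 'k) \<Rightarrow> bool" where
  "symmetric_on V form \<longleftrightarrow> (\<forall>x\<in>V. \<forall>y\<in>V. form x y = form y x)"

text \<open>Only used for symmetric forms, so one of the two radicals suffices.\<close>

definition nondegenerate_on :: "'v::zero set \<Rightarrow> ('v \<Rightarrow> 'v \<Rightarrow> 'k::zero) \<Rightarrow> bool" where
  "nondegenerate_on V form \<longleftrightarrow> (\<forall>x\<in>V. (\<forall>y\<in>V. form x y = 0) \<longrightarrow> x = 0)"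

definition dual_space :: "('k::field \<Rightarrow> 'a::ab_group_add \<Rightarrow> 'a) \<Rightarrow> ('a \<Rightarrow> 'k) set" where
  "dual_space s = {f. Vector_Spaces.linear s (*) f}"


section \<open>Algebras\<close>

definition algebra_on ::
  "('k::field \<Rightarrow> 'v::ab_group_add \<Rightarrow> 'v) \<Rightarrow> 'v set \<Rightarrow> ('v \<Rightarrow> 'v \<Rightarrow> 'v) \<Rightarrow> bool"
where
  "algebra_on s V m \<longleftrightarrow> vector_space s \<and> module.subspace s V \<and>
     (\<forall>x\<in>V. \<forall>y\<in>V. m x y \<in> V) \<and> bilinear_on s V s V s m"

definition novikov_algebra ::
  "('k::field \<Rightarrow> 'v::ab_group_add \<Rightarrow> 'v) \<Rightarrow> 'v set \<Rightarrow> ('v \<Rightarrow> 'v \<Rightarrow> 'v) \<Rightarrow> bool"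
where
  "novikov_algebra s V m \<longleftrightarrow> algebra_on s V m \<and>
     (\<forall>a\<in>V. \<forall>b\<in>V. \<forall>c\<in>V. m (m a b) c - m a (m b c) = m (m b a) c - m b (m a c)) \<and>
     (\<forall>a\<in>V. \<forall>b\<in>V. \<forall>c\<in>V. m (m a b) c = m (m a c) b)"

definition right_novikov_algebra ::
  "('k::field \<Rightarrow> 'v::ab_group_add \<Rightarrow> 'v) \<Rightarrow> 'v set \<Rightarrow> ('v \<Rightarrow> 'v \<Rightarrow> 'v) \<Rightarrow> bool"
where
  "right_novikov_algebra s V m \<longleftrightarrow> algebra_on s V m \<and>
     (\<forall>a\<in>V. \<forall>b\<in>V. \<forall>c\<in>V. m (m a b) c - m a (m b c) = m (m a c) b - m a (m c b)) \<and>
     (\<forall>a\<in>V. \<forall>b\<in>V. \<forall>c\<in>V. m a (m b c) = m b (m a c))"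

definition quadratic_right_novikov_algebra ::
  "('k::field \<Rightarrow> 'v::ab_group_add \<Rightarrow> 'v) \<Rightarrow> 'v set \<Rightarrow> ('v \<Rightarrow> 'v \<Rightarrow> 'v) \<Rightarrow> ('v \<Rightarrow> 'v \<Rightarrow> 'k) \<Rightarrow> bool"
where
  "quadratic_right_novikov_algebra s V m form \<longleftrightarrow> right_novikov_algebra s V m \<and>
     bilinear_form_on s V form \<and> symmetric_on V form \<and> nondegenerate_on V form \<and>
     (\<forall>a\<in>V. \<forall>b\<in>V. \<forall>c\<in>V. form (m a b) c = - form a (m b c + m c b))"

definition lie_algebra ::
  "('k::field \<Rightarrow> 'v::ab_group_add \<Rightarrow> 'v) \<Rightarrow> 'v set \<Rightarrow> ('v \<Rightarrow> 'v \<Rightarrow> 'v) \<Rightarrow> bool"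
where
  "lie_algebra s L br \<longleftrightarrow> algebra_on s L br \<and>
     (\<forall>x\<in>L. br x x = 0) \<and>
     (\<forall>x\<in>L. \<forall>y\<in>L. \<forall>z\<in>L. br x (br y z) + br y (br z x) + br z (br x y) = 0)"

definition lie_subalgebra ::
  "('k::field \<Rightarrow> 'v::ab_group_add \<Rightarrow> 'v) \<Rightarrow> 'v set \<Rightarrow> ('v \<Rightarrow> 'v \<Rightarrow> 'v) \<Rightarrow> 'v set \<Rightarrow> bool"
where
  "lie_subalgebra s L br M \<longleftrightarrow> module.subspace s M \<and> M \<subseteq> L \<and> (\<forall>x\<in>M. \<forall>y\<in>M. br x y \<in> M)"

definition lie_algebra_embedding ::
  "('k::field \<Rightarrow> 'v::ab_group_add \<Rightarrow> 'v) \<Rightarrow> 'v set \<Rightarrow> ('v \<Rightarrow> 'v \<Rightarrow> 'v) \<Rightarrow>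
   ('k \<Rightarrow> 'u::ab_group_add \<Rightarrow> 'u) \<Rightarrow> 'u set \<Rightarrow> ('u \<Rightarrow> 'u \<Rightarrow> 'u) \<Rightarrow> ('v \<Rightarrow> 'u) \<Rightarrow> bool"
where
  "lie_algebra_embedding s1 L1 br1 s2 L2 br2 h \<longleftrightarrow>
     lie_algebra s1 L1 br1 \<and> lie_algebra s2 L2 br2 \<and>
     h ` L1 \<subseteq> L2 \<and> linear_on s1 L1 s2 h \<and> inj_on h L1 \<and>
     (\<forall>x\<in>L1. \<forall>y\<in>L1. h (br1 x y) = br2 (h x) (h y))"


section \<open>Tensor products\<close>

text \<open>
  The tensor product \<open>V \<otimes> W\<close> is realised inside the dual of the space of bilinear forms on
  \<open>V \<times> W\<close>: \<open>v \<otimes> w\<close> is the evaluation \<open>\<beta> \<mapsto> \<beta> v w\<close>, and \<open>V \<otimes> W\<close> is the span of these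
  evaluations. That this is the tensor product is \<open>tensor_universal_property\<close> below.
  Thus for \<open>u \<in> V \<otimes> W\<close> and a bilinear form \<open>\<beta>\<close>, the scalar \<open>u \<beta>\<close> is the value at \<open>u\<close> of the
  linear map on \<open>V \<otimes> W\<close> that extends \<open>\<beta>\<close>.
\<close>

definition bilinear_forms ::
  "('k::field \<Rightarrow> 'v::ab_group_add \<Rightarrow> 'v) \<Rightarrow> 'v set \<Rightarrow> ('k \<Rightarrow> 'w::ab_group_add \<Rightarrow> 'w) \<Rightarrow> 'w set \<Rightarrow>
   ('v \<Rightarrow> 'w \<Rightarrow> 'k) set"
where
  "bilinear_forms sV V sW W = {\<beta>. bilinear_on sV V sW W (*) \<beta>}"

definition tensor ::
  "('k::field \<Rightarrow> 'v::ab_group_add \<Rightarrow> 'v) \<Rightarrow> 'v set \<Rightarrow> ('k \<Rightarrow> 'w::ab_group_add \<Rightarrow> 'w) \<Rightarrow> 'w set \<Rightarrow>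
   'v \<Rightarrow> 'w \<Rightarrow> (('v \<Rightarrow> 'w \<Rightarrow> 'k) \<Rightarrow> 'k)"
where
  "tensor sV V sW W v w = (\<lambda>\<beta>. if \<beta> \<in> bilinear_forms sV V sW W then \<beta> v w else 0)"

definition tensor_space ::
  "('k::field \<Rightarrow> 'v::ab_group_add \<Rightarrow> 'v) \<Rightarrow> 'v set \<Rightarrow> ('k \<Rightarrow> 'w::ab_group_add \<Rightarrow> 'w) \<Rightarrow> 'w set \<Rightarrow>
   (('v \<Rightarrow> 'w \<Rightarrow> 'k) \<Rightarrow> 'k) set"
where
  "tensor_space sV V sW W = module.span fun_scale {tensor sV V sW W v w | v w. v \<in> V \<and> w \<in> W}"

text \<open>The map \<open>j \<otimes> id\<close>, see \<open>tensor_map_tensor\<close>; \<open>V'\<close> is the target of \<open>j\<close>.\<close>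

definition tensor_map ::
  "('k::field \<Rightarrow> 'u::ab_group_add \<Rightarrow> 'u) \<Rightarrow> 'u set \<Rightarrow> ('k \<Rightarrow> 'w::ab_group_add \<Rightarrow> 'w) \<Rightarrow> 'w set \<Rightarrow>
   ('v \<Rightarrow> 'u) \<Rightarrow> (('v \<Rightarrow> 'w \<Rightarrow> 'k) \<Rightarrow> 'k) \<Rightarrow> (('u \<Rightarrow> 'w \<Rightarrow> 'k) \<Rightarrow> 'k)"
where
  "tensor_map sV' V' sW W j t =
     (\<lambda>\<beta>. if \<beta> \<in> bilinear_forms sV' V' sW W then t (\<lambda>v w. \<beta> (j v) w) else 0)"

text \<open>
  The bilinear extension of
  \<open>[a\<^sub>1 \<otimes> b\<^sub>1, a\<^sub>2 \<otimes> b\<^sub>2] = (a\<^sub>1 \<circ> a\<^sub>2) \<otimes> (b\<^sub>1 \<diamond> b\<^sub>2) - (a\<^sub>2 \<circ> a\<^sub>1) \<otimes> (b\<^sub>2 \<diamond> b\<^sub>1)\<close>, see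
  \<open>induced_bracket_tensor\<close> and \<open>induced_bracket_bilinear\<close>.
\<close>

definition induced_bracket ::
  "('k::field \<Rightarrow> 'v::ab_group_add \<Rightarrow> 'v) \<Rightarrow> 'v set \<Rightarrow> ('k \<Rightarrow> 'w::ab_group_add \<Rightarrow> 'w) \<Rightarrow> 'w set \<Rightarrow>
   ('v \<Rightarrow> 'v \<Rightarrow> 'v) \<Rightarrow> ('w \<Rightarrow> 'w \<Rightarrow> 'w) \<Rightarrow>
   (('v \<Rightarrow> 'w \<Rightarrow> 'k) \<Rightarrow> 'k) \<Rightarrow> (('v \<Rightarrow> 'w \<Rightarrow> 'k) \<Rightarrow> 'k) \<Rightarrow> (('v \<Rightarrow> 'w \<Rightarrow> 'k) \<Rightarrow> 'k)"
where
  "induced_bracket sV V sW W circ dia t t' =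
     (\<lambda>\<beta>. if \<beta> \<in> bilinear_forms sV V sW W
           then t (\<lambda>a1 b1. t' (\<lambda>a2 b2. \<beta> (circ a1 a2) (dia b1 b2) - \<beta> (circ a2 a1) (dia b2 b1)))
           else 0)"


section \<open>Manin triples\<close>

definition double_space :: "('k::field \<Rightarrow> 'a::ab_group_add \<Rightarrow> 'a) \<Rightarrow> ('a \<times> ('a \<Rightarrow> 'k)) set" where
  "double_space sA = UNIV \<times> dual_space sA"

definition double_scale ::
  "('k::field \<Rightarrow> 'a::ab_group_add \<Rightarrow> 'a) \<Rightarrow> 'k \<Rightarrow> 'a \<times> ('a \<Rightarrow> 'k) \<Rightarrow> 'a \<times> ('a \<Rightarrow> 'k)"
where
  "double_scale sA = module_prod.scale sA fun_scale"

definition double_pairing :: "'a \<times> ('a \<Rightarrow> 'k::field) \<Rightarrow> 'a \<times> ('a \<Rightarrow> 'k) \<Rightarrow> 'k" where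
  "double_pairing x y = snd x (fst y) + snd y (fst x)"

definition manin_triple_novikov ::
  "('k::field \<Rightarrow> 'a::ab_group_add \<Rightarrow> 'a) \<Rightarrow> ('a \<Rightarrow> 'a \<Rightarrow> 'a) \<Rightarrow>
   (('a \<Rightarrow> 'k) \<Rightarrow> ('a \<Rightarrow> 'k) \<Rightarrow> ('a \<Rightarrow> 'k)) \<Rightarrow>
   ('a \<times> ('a \<Rightarrow> 'k) \<Rightarrow> 'a \<times> ('a \<Rightarrow> 'k) \<Rightarrow> 'a \<times> ('a \<Rightarrow> 'k)) \<Rightarrow> bool"
where
  "manin_triple_novikov sA circ bul mul \<longleftrightarrow>
     novikov_algebra (double_scale sA) (double_space sA) mul \<and>
     novikov_algebra sA UNIV circ \<and>
     novikov_algebra fun_scale (dual_space sA) bul \<and>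
     (\<forall>a b. mul (a, 0) (b, 0) = (circ a b, 0)) \<and>
     (\<forall>f\<in>dual_space sA. \<forall>g\<in>dual_space sA. mul (0, f) (0, g) = (0, bul f g)) \<and>
     (\<forall>x\<in>double_space sA. \<forall>y\<in>double_space sA. \<forall>z\<in>double_space sA.
        double_pairing (mul x y) z = - double_pairing y (mul x z + mul z x))"

definition manin_triple_lie ::
  "('k::field \<Rightarrow> 'v::ab_group_add \<Rightarrow> 'v) \<Rightarrow> 'v set \<Rightarrow> ('v \<Rightarrow> 'v \<Rightarrow> 'v) \<Rightarrow> 'v set \<Rightarrow> 'v set \<Rightarrow>
   ('v \<Rightarrow> 'v \<Rightarrow> 'k) \<Rightarrow> bool"
where
  "manin_triple_lie s L br L1 L2 form \<longleftrightarrow>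
     lie_algebra s L br \<and>
     bilinear_form_on s L form \<and> nondegenerate_on L form \<and> symmetric_on L form \<and>
     (\<forall>x\<in>L. \<forall>y\<in>L. \<forall>z\<in>L. form (br x y) z = form x (br y z)) \<and>
     lie_subalgebra s L br L1 \<and> lie_subalgebra s L br L2 \<and>
     L = {x + y | x y. x \<in> L1 \<and> y \<in> L2} \<and> L1 \<inter> L2 = {0} \<and>
     (\<forall>x\<in>L1. \<forall>y\<in>L1. form x y = 0) \<and> (\<forall>x\<in>L2. \<forall>y\<in>L2. form x y = 0)"

text \<open>
  The bilinear form on \<open>(A \<oplus> A\<^sup>*) \<otimes> B\<close> extending
  \<open>(x \<otimes> b, y \<otimes> c) \<mapsto> double_pairing x y * form b c\<close>, see \<open>double_form_tensor\<close>.
\<close>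

definition double_form ::
  "('b \<Rightarrow> 'b \<Rightarrow> 'k::field) \<Rightarrow>
   ((('a \<times> ('a \<Rightarrow> 'k)) \<Rightarrow> 'b \<Rightarrow> 'k) \<Rightarrow> 'k) \<Rightarrow> ((('a \<times> ('a \<Rightarrow> 'k)) \<Rightarrow> 'b \<Rightarrow> 'k) \<Rightarrow> 'k) \<Rightarrow> 'k"
where
  "double_form form t t' = t (\<lambda>x b. t' (\<lambda>y c. double_pairing x y * form b c))"


section \<open>Basic properties\<close>

lemma vector_space_fun_scale: "vector_space (fun_scale :: 'k::field \<Rightarrow> ('x \<Rightarrow> 'k) \<Rightarrow> _)"
  by unfold_locales (auto simp: fun_scale_def fun_eq_iff algebra_simps)

interpretation fs: vector_space "fun_scale :: 'k::field \<Rightarrow> ('x \<Rightarrow> 'k) \<Rightarrow> _"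
  by (rule vector_space_fun_scale)

lemma bilinear_onD:
  assumes "bilinear_on s1 V s2 W s3 h"
  shows "x \<in> V \<Longrightarrow> x' \<in> V \<Longrightarrow> y \<in> W \<Longrightarrow> h (x + x') y = h x y + h x' y"
    and "x \<in> V \<Longrightarrow> y \<in> W \<Longrightarrow> h (s1 c x) y = s3 c (h x y)"
    and "x \<in> V \<Longrightarrow> y \<in> W \<Longrightarrow> y' \<in> W \<Longrightarrow> h x (y + y') = h x y + h x y'"
    and "x \<in> V \<Longrightarrow> y \<in> W \<Longrightarrow> h x (s2 c y) = s3 c (h x y)"
  using assms by (auto simp: bilinear_on_def linear_on_def)

lemma tensor_bilinear: "bilinear_on sV V sW W fun_scale (tensor sV V sW W)"
  by (auto simp: bilinear_on_def linear_on_def tensor_def fun_scale_def fun_eq_iff bilinear_forms_def)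

lemma tensor_in_tensor_space: "v \<in> V \<Longrightarrow> w \<in> W \<Longrightarrow> tensor sV V sW W v w \<in> tensor_space sV V sW W"
  unfolding tensor_space_def by (rule fs.span_base) blast

lemma subspace_tensor_space: "fs.subspace (tensor_space sV V sW W)"
  unfolding tensor_space_def by (rule fs.subspace_span)

lemma tensor_space_induct [consumes 1, case_names zero add]:
  assumes "t \<in> tensor_space sV V sW W"
    and "P 0"
    and "\<And>c v w t. v \<in> V \<Longrightarrow> w \<in> W \<Longrightarrow> t \<in> tensor_space sV V sW W \<Longrightarrow> P t \<Longrightarrow>
           P (fun_scale c (tensor sV V sW W v w) + t)"
  shows "P t"
proof -
  have "t \<in> tensor_space sV V sW W \<and> P t"
    using assms(1)[unfolded tensor_space_def]
  proof (induction rule: fs.span_induct_alt)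
    case base
    then show ?case using assms(2) subspace_tensor_space fs.subspace_0 by blast
  next
    case (step c x y)
    then obtain v w where "x = tensor sV V sW W v w" "v \<in> V" "w \<in> W" by blast
    with step show ?case
      using assms(3) tensor_in_tensor_space subspace_tensor_space fs.subspace_add fs.subspace_scale
      by metis
  qed
  then show ?thesis ..
qed

lemma tensor_space_linear:
  assumes "t \<in> tensor_space sV V sW W" "\<beta> \<in> bilinear_forms sV V sW W" "\<gamma> \<in> bilinear_forms sV V sW W"
  shows "(\<lambda>v w. \<beta> v w + \<gamma> v w) \<in> bilinear_forms sV V sW W"
    and "(\<lambda>v w. c * \<beta> v w) \<in> bilinear_forms sV V sW W"
    and "t (\<lambda>v w. \<beta> v w + \<gamma> v w) = t \<beta> + t \<gamma>"
    and "t (\<lambda>v w. c * \<beta> v w) = c * t \<beta>"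
proof -
  show 1: "(\<lambda>v w. \<beta> v w + \<gamma> v w) \<in> bilinear_forms sV V sW W"
    and 2: "(\<lambda>v w. c * \<beta> v w) \<in> bilinear_forms sV V sW W"
    using assms(2,3) by (auto simp: bilinear_forms_def bilinear_on_def linear_on_def algebra_simps)
  show "t (\<lambda>v w. \<beta> v w + \<gamma> v w) = t \<beta> + t \<gamma>"
    using assms(1)
    by (induction rule: tensor_space_induct)
       (use 1 assms in \<open>auto simp: fun_scale_def tensor_def algebra_simps\<close>)
  show "t (\<lambda>v w. c * \<beta> v w) = c * t \<beta>"
    using assms(1)
    by (induction rule: tensor_space_induct)
       (use 2 assms in \<open>auto simp: fun_scale_def tensor_def algebra_simps\<close>)
qed

lemma tensor_space_cong:
  assumes "t \<in> tensor_space sV V sW W" "\<And>v w. v \<in> V \<Longrightarrow> w \<in> W \<Longrightarrow> \<beta> v w = \<gamma> v w"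
    and "\<beta> \<in> bilinear_forms sV V sW W" "\<gamma> \<in> bilinear_forms sV V sW W"
  shows "t \<beta> = t \<gamma>"
  using assms(1)
  by (induction rule: tensor_space_induct) (use assms in \<open>auto simp: fun_scale_def tensor_def\<close>)

theorem tensor_universal_property:
  fixes sV :: "'k::field \<Rightarrow> 'v::ab_group_add \<Rightarrow> 'v" and sW :: "'k \<Rightarrow> 'w::ab_group_add \<Rightarrow> 'w"
    and sU :: "'k \<Rightarrow> 'u::ab_group_add \<Rightarrow> 'u"
  assumes "vector_space sU" and bil: "bilinear_on sV V sW W sU \<phi>"
  shows "\<exists>\<Phi>. linear_on fun_scale (tensor_space sV V sW W) sU \<Phi> \<and>
             (\<forall>v\<in>V. \<forall>w\<in>W. \<Phi> (tensor sV V sW W v w) = \<phi> v w) \<and>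
             (\<forall>\<Psi>. linear_on fun_scale (tensor_space sV V sW W) sU \<Psi> \<and>
                  (\<forall>v\<in>V. \<forall>w\<in>W. \<Psi> (tensor sV V sW W v w) = \<phi> v w) \<longrightarrow>
                  (\<forall>t\<in>tensor_space sV V sW W. \<Psi> t = \<Phi> t))"
proof -
  interpret U: vector_space sU by fact
  interpret K: vector_space "(*) :: 'k \<Rightarrow> 'k \<Rightarrow> 'k" by unfold_locales (auto simp: algebra_simps)
  interpret UK: vector_space_pair sU "(*) :: 'k \<Rightarrow> 'k \<Rightarrow> 'k" by unfold_locales
  let ?T = "tensor_space sV V sW W"
  define R where "R t u \<longleftrightarrow> (\<forall>f. Vector_Spaces.linear sU (*) f \<longrightarrow> t (\<lambda>v w. f (\<phi> v w)) = f u)" for t u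
  have fbil: "(\<lambda>v w. f (\<phi> v w)) \<in> bilinear_forms sV V sW W"
    if "Vector_Spaces.linear sU (*) f" for f
    using bil that
    by (auto simp: bilinear_forms_def bilinear_on_def linear_on_def UK.linear_add UK.linear_scale)
  have R_tensor: "R (tensor sV V sW W v w) (\<phi> v w)" for v w
    using fbil by (auto simp: R_def tensor_def)
  have R_add: "R (t + t') (u + u')" if "R t u" "R t' u'" for t t' u u'
    using that by (auto simp: R_def UK.linear_add)
  have R_scale: "R (fun_scale c t) (sU c u)" if "R t u" for c t u
    using that by (auto simp: R_def UK.linear_scale fun_scale_def)
  have R_ex: "\<exists>u. R t u" if "t \<in> ?T" for t
    using that
  proof (induction rule: tensor_space_induct)
    case zero
    have "R 0 0" by (auto simp: R_def UK.linear_0)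
    then show ?case ..
  next
    case (add c v w t)
    then show ?case using R_add R_scale R_tensor by blast
  qed
  have R_unique: "u = u'" if "R t u" "R t u'" for t u u'
  proof (rule ccontr)
    assume "u \<noteq> u'"
    then have "U.independent {u - u'}" by simp
    then obtain f where f: "Vector_Spaces.linear sU (*) f" "f (u - u') = 1"
      using UK.linear_independent_extend[of "{u - u'}" "\<lambda>_. 1"] by auto
    with that have "f u = f u'" by (auto simp: R_def)
    with f show False by (simp add: UK.linear_diff)
  qed
  define \<Phi> where "\<Phi> t = (THE u. R t u)" for t
  have \<Phi>I: "\<Phi> t = u" if "R t u" for t u
    unfolding \<Phi>_def using that R_unique by blast
  have R\<Phi>: "R t (\<Phi> t)" if "t \<in> ?T" for t
    using R_ex[OF that] \<Phi>I by blast
  have lin: "linear_on fun_scale ?T sU \<Phi>"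
    unfolding linear_on_def
  proof (intro conjI ballI allI)
    fix t t' c assume t: "t \<in> ?T"
    show "\<Phi> (fun_scale c t) = sU c (\<Phi> t)" by (rule \<Phi>I[OF R_scale[OF R\<Phi>[OF t]]])
    assume t': "t' \<in> ?T"
    show "\<Phi> (t + t') = \<Phi> t + \<Phi> t'" by (rule \<Phi>I[OF R_add[OF R\<Phi>[OF t] R\<Phi>[OF t']]])
  qed
  have val: "\<Phi> (tensor sV V sW W v w) = \<phi> v w" for v w
    using R_tensor by (rule \<Phi>I)
  have uniq: "\<Psi> t = \<Phi> t"
    if \<Psi>: "linear_on fun_scale ?T sU \<Psi>" "\<forall>v\<in>V. \<forall>w\<in>W. \<Psi> (tensor sV V sW W v w) = \<phi> v w"
      and t: "t \<in> ?T" for \<Psi> t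
    using t
  proof (induction rule: tensor_space_induct)
    case zero
    have z: "(0 :: ('v \<Rightarrow> 'w \<Rightarrow> 'k) \<Rightarrow> 'k) \<in> ?T"
      by (rule fs.subspace_0[OF subspace_tensor_space])
    have "\<Psi> (0 + 0) = \<Psi> 0 + \<Psi> 0" "\<Phi> (0 + 0) = \<Phi> 0 + \<Phi> 0"
      using \<Psi>(1) lin z unfolding linear_on_def by blast+
    then have "\<Psi> 0 = 0" "\<Phi> 0 = 0" by simp_all
    then show ?case by metis
  next
    case (add c v w t)
    let ?x = "tensor sV V sW W v w"
    have x: "?x \<in> ?T" by (rule tensor_in_tensor_space[OF add(1,2)])
    have cx: "fun_scale c ?x \<in> ?T" by (rule fs.subspace_scale[OF subspace_tensor_space x])
    have "\<Psi> (fun_scale c ?x + t) = sU c (\<Psi> ?x) + \<Psi> t"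
      using \<Psi>(1) x cx add(3) unfolding linear_on_def by simp
    moreover have "\<Phi> (fun_scale c ?x + t) = sU c (\<Phi> ?x) + \<Phi> t"
      using lin x cx add(3) unfolding linear_on_def by simp
    moreover have "\<Psi> ?x = \<Phi> ?x"
      using \<Psi>(2) val add(1,2) by simp
    ultimately show ?case using add(4) by metis
  qed
  show ?thesis
    by (rule exI[of _ \<Phi>], intro conjI ballI allI impI)
       (rule lin, rule val, erule conjE, rule uniq, assumption+)
qed

lemma tensor_map_tensor:
  assumes "linear_on sV V sV' j" "j ` V \<subseteq> V'"
  shows "tensor_map sV' V' sW W j (tensor sV V sW W v w) = tensor sV' V' sW W (j v) w"
proof -
  have "(\<lambda>v w. \<beta> (j v) w) \<in> bilinear_forms sV V sW W" if "\<beta> \<in> bilinear_forms sV' V' sW W" for \<beta>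
    using that assms by (force simp: bilinear_forms_def bilinear_on_def linear_on_def image_subset_iff)
  then show ?thesis by (auto simp: tensor_map_def tensor_def fun_eq_iff)
qed

lemma induced_bracket_form_right:
  assumes A: "algebra_on sV V circ" and B: "algebra_on sW W dia"
    and \<beta>: "\<beta> \<in> bilinear_forms sV V sW W" and "a1 \<in> V" "b1 \<in> W"
  shows "(\<lambda>a2 b2. \<beta> (circ a1 a2) (dia b1 b2) - \<beta> (circ a2 a1) (dia b2 b1)) \<in> bilinear_forms sV V sW W"
  using assms by (auto simp: algebra_on_def bilinear_forms_def bilinear_on_def linear_on_def algebra_simps)

lemma induced_bracket_form_left:
  assumes A: "algebra_on sV V circ" and B: "algebra_on sW W dia"
    and \<beta>: "\<beta> \<in> bilinear_forms sV V sW W" and t: "t \<in> tensor_space sV V sW W"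
  shows "(\<lambda>a1 b1. t (\<lambda>a2 b2. \<beta> (circ a1 a2) (dia b1 b2) - \<beta> (circ a2 a1) (dia b2 b1)))
           \<in> bilinear_forms sV V sW W"
  using t
proof (induction rule: tensor_space_induct)
  case zero
  then show ?case by (auto simp: bilinear_forms_def bilinear_on_def linear_on_def)
next
  case (add c v w t)
  let ?G = "\<lambda>a1 b1 a2 b2. \<beta> (circ a1 a2) (dia b1 b2) - \<beta> (circ a2 a1) (dia b2 b1)"
  have 1: "(\<lambda>a1 b1. ?G a1 b1 v w) \<in> bilinear_forms sV V sW W"
    using A B \<beta> add(1,2)
    by (auto simp: algebra_on_def bilinear_forms_def bilinear_on_def linear_on_def algebra_simps)
  have 2: "(\<lambda>a1 b1. c * ?G a1 b1 v w + t (?G a1 b1)) \<in> bilinear_forms sV V sW W"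
    using tensor_space_linear(1)[OF add(3) tensor_space_linear(2)[OF add(3) 1 1] add(4)] .
  have eq: "(fun_scale c (tensor sV V sW W v w) + t) (?G a1 b1) = c * ?G a1 b1 v w + t (?G a1 b1)"
    if "a1 \<in> V" "b1 \<in> W" for a1 b1
    using induced_bracket_form_right[OF A B \<beta> that] by (simp add: fun_scale_def tensor_def)
  have V: "x + y \<in> V" "sV d x \<in> V" if "x \<in> V" "y \<in> V" for x y d
    using A that unfolding algebra_on_def
    by (metis module.subspace_add module.subspace_scale module_iff_vector_space)+
  have W: "x + y \<in> W" "sW d x \<in> W" if "x \<in> W" "y \<in> W" for x y d
    using B that unfolding algebra_on_def
    by (metis module.subspace_add module.subspace_scale module_iff_vector_space)+
  show ?case
    using 2 unfolding bilinear_forms_def bilinear_on_def linear_on_def mem_Collect_eq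
    by (simp add: eq V W del: plus_fun_apply)
qed

lemma induced_bracket_tensor:
  assumes "algebra_on sV V circ" "algebra_on sW W dia" "a1 \<in> V" "a2 \<in> V" "b1 \<in> W" "b2 \<in> W"
  shows "induced_bracket sV V sW W circ dia (tensor sV V sW W a1 b1) (tensor sV V sW W a2 b2) =
         tensor sV V sW W (circ a1 a2) (dia b1 b2) - tensor sV V sW W (circ a2 a1) (dia b2 b1)"
  using assms induced_bracket_form_right[OF assms(1,2)]
    induced_bracket_form_left[OF assms(1,2) _ tensor_in_tensor_space[OF assms(4,6)]]
  by (auto simp: induced_bracket_def fun_eq_iff) (auto simp: tensor_def)

lemma induced_bracket_bilinear:
  assumes A: "algebra_on sV V circ" and B: "algebra_on sW W dia"
  shows "bilinear_on fun_scale (tensor_space sV V sW W) fun_scale (tensor_space sV V sW W) fun_scale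
           (induced_bracket sV V sW W circ dia)"
  unfolding bilinear_on_def linear_on_def induced_bracket_def
  by (auto simp: fun_eq_iff fun_scale_def
        tensor_space_linear(3,4)[OF _ induced_bracket_form_left[OF A B] induced_bracket_form_left[OF A B]])

lemma double_form_tensor:
  assumes "vector_space sA" "vector_space sB" "bilinear_form_on sB UNIV form"
    and "x \<in> double_space sA" "y \<in> double_space sA"
  defines "tn \<equiv> tensor (double_scale sA) (double_space sA) sB UNIV"
  shows "double_form form (tn x b) (tn y c) = double_pairing x y * form b c"
proof -
  let ?BF = "bilinear_forms (double_scale sA) (double_space sA) sB UNIV"
  interpret A: vector_space sA by fact
  interpret P: vector_space_pair sA "fun_scale :: 'a \<Rightarrow> ('b \<Rightarrow> 'a) \<Rightarrow> _" by unfold_locales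
  interpret Q: module_prod sA "fun_scale :: 'a \<Rightarrow> ('b \<Rightarrow> 'a) \<Rightarrow> _" by unfold_locales
  note defs = bilinear_forms_def bilinear_on_def linear_on_def bilinear_form_on_def double_pairing_def
    double_scale_def Q.scale_def double_space_def dual_space_def fun_scale_def
    Vector_Spaces.linear_iff algebra_simps
  have r: "(\<lambda>y c. double_pairing x y * form b c) \<in> ?BF" if "x \<in> double_space sA" for x b
    using assms(3) that by (auto simp: defs)
  have l: "(\<lambda>x b. double_pairing x y * form b c) \<in> ?BF"
    using assms(3,5) by (auto simp: defs)
  have l': "(\<lambda>x b. tn y c (\<lambda>y c. double_pairing x y * form b c)) \<in> ?BF"
  proof -
    have eq: "tn y c (\<lambda>y c. double_pairing x y * form b c) = double_pairing x y * form b c"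
      if "x \<in> double_space sA" for x b
      using r[OF that] by (simp add: tn_def tensor_def)
    have cl: "u + v \<in> double_space sA" "double_scale sA d u \<in> double_space sA"
      if "u \<in> double_space sA" "v \<in> double_space sA" for u v d
      using that by (auto simp: defs)
    show ?thesis
      using l unfolding bilinear_forms_def bilinear_on_def linear_on_def mem_Collect_eq
      by (simp add: eq cl)
  qed
  show ?thesis
    using l' r[OF assms(4)] unfolding double_form_def by (simp add: tn_def tensor_def)
qed

end

theory Submission
  imports Defs
begin

text \<open>
  Write \<open>V = A \<oplus> A\<^sup>*\<close> with its canonical pairing \<open>P\<close>, and \<open>Q\<close> for the form of \<open>B\<close>. The form on
  \<open>L = V \<otimes> B\<close> is the tensor product \<open>P \<otimes> Q\<close>, so every claim about \<open>L\<close> can be separated into a claim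
  about \<open>V\<close> and a claim about \<open>B\<close>. Identities between multilinear maps on \<open>L\<close> need to be checked on
  pure tensors only (\<open>linear_on_tensor_space_eq\<close>, \<open>trilinear_tensor_space_zero\<close>).

  The Jacobi identity (\<open>induced_lie_algebra\<close>) comes from a normal form for products of three
  elements. In a Novikov algebra \<open>u\<^sub>i = (a\<^sub>i a\<^sub>j) a\<^sub>k\<close> does not depend on the order of \<open>j, k\<close>, and
  \<open>p\<^sub>k = a\<^sub>i (a\<^sub>j a\<^sub>k) - u\<^sub>i\<close> does not depend on the order of \<open>i, j\<close>. Dually, in a right Novikov
  algebra \<open>v\<^sub>k = b\<^sub>i (b\<^sub>j b\<^sub>k)\<close> and \<open>q\<^sub>i = (b\<^sub>i b\<^sub>j) b\<^sub>k - v\<^sub>k\<close> are symmetric in the other two indices. In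
  these terms the Jacobi sum cancels.

  Invariance (\<open>tensor_form_invariant\<close>) comes from applying the invariance of \<open>P\<close> and \<open>Q\<close> to permuted
  arguments: together with symmetry it gives \<open>P(xy, z) = P(x, zy)\<close> and \<open>Q(cb, d) = Q(b, cd)\<close>, after
  which both sides have the same expansion on pure tensors.

  Nondegeneracy (\<open>tensor_form_nondegenerate\<close>) uses finite dimension twice. Nondegeneracy of \<open>Q\<close>
  gives dual bases of \<open>B\<close>, and reflexivity of \<open>A\<close> represents each functional on \<open>V\<close> by \<open>P\<close>. Hence
  every bilinear form on \<open>V \<times> B\<close> is a finite sum of forms \<open>P(-, y) Q(-, c)\<close>, and an element of \<open>L\<close>
  orthogonal to all \<open>y \<otimes> c\<close> is killed by every bilinear form, so it is zero.

  The inclusions of \<open>A\<close> and \<open>A\<^sup>*\<close> into \<open>V\<close> are split homomorphisms, so they induce embeddings of Lie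
  algebras (\<open>tensor_map_lie_algebra_embedding\<close>). The images are isotropic because \<open>A\<close> and
  \<open>A\<^sup>*\<close> are, and they span \<open>L\<close>; by nondegeneracy they therefore intersect in zero.
\<close>

section \<open>Linear maps on tensor products\<close>

lemma linear_onD:
  assumes "linear_on s1 V s2 h"
  shows "x \<in> V \<Longrightarrow> y \<in> V \<Longrightarrow> h (x + y) = h x + h y"
    and "x \<in> V \<Longrightarrow> h (s1 c x) = s2 c (h x)"
  using assms by (auto simp: linear_on_def)

lemma linear_on_zero:
  assumes "linear_on s1 V s2 h" "0 \<in> V"
  shows "h 0 = 0"
proof -
  have "h (0 + 0) = h 0 + h 0" using linear_onD(1)[OF assms(1)] assms(2) by blast
  then show ?thesis by simp
qed

lemma linear_on_diff:
  assumes "linear_on s1 V s2 h" "x \<in> V" "y \<in> V" "x - y \<in> V"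
  shows "h (x - y) = h x - h y"
  using linear_onD(1)[OF assms(1,4,3)] by (simp add: eq_diff_eq)

lemma linear_on_sum:
  assumes h: "linear_on s1 V s2 h" and V: "vector_space s1" "module.subspace s1 V"
    and f: "\<And>i. i \<in> I \<Longrightarrow> f i \<in> V"
  shows "h (\<Sum>i\<in>I. f i) = (\<Sum>i\<in>I. h (f i))"
proof -
  interpret vector_space s1 by fact
  show ?thesis
    using f
  proof (induction I rule: infinite_finite_induct)
    case (insert i I)
    then show ?case
      using linear_onD(1)[OF h, of "f i" "sum f I"] V(2) by (simp add: subspace_sum)
  qed (use linear_on_zero[OF h] V(2) in \<open>auto intro: subspace_0\<close>)
qed

lemma tensor_space_zero: "0 \<in> tensor_space sV V sW W"
  and tensor_space_add: "t \<in> tensor_space sV V sW W \<Longrightarrow> t' \<in> tensor_space sV V sW W \<Longrightarrow>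
    t + t' \<in> tensor_space sV V sW W"
  and tensor_space_scale: "t \<in> tensor_space sV V sW W \<Longrightarrow> fun_scale c t \<in> tensor_space sV V sW W"
  and tensor_space_diff: "t \<in> tensor_space sV V sW W \<Longrightarrow> t' \<in> tensor_space sV V sW W \<Longrightarrow>
    t - t' \<in> tensor_space sV V sW W"
  using subspace_tensor_space
  by (blast intro: fs.subspace_0 fs.subspace_add fs.subspace_scale fs.subspace_diff)+

lemmas tensor_space_closed = tensor_space_zero tensor_space_add tensor_space_scale
  tensor_space_diff tensor_in_tensor_space

lemma linear_on_tensor_space_eq:
  assumes h: "linear_on fun_scale (tensor_space sV V sW W) s h"
    and h': "linear_on fun_scale (tensor_space sV V sW W) s h'"
    and eq: "\<And>v w. v \<in> V \<Longrightarrow> w \<in> W \<Longrightarrow> h (tensor sV V sW W v w) = h' (tensor sV V sW W v w)"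
    and t: "t \<in> tensor_space sV V sW W"
  shows "h t = h' t"
  using t
proof (induction rule: tensor_space_induct)
  case zero
  show ?case
    using linear_on_zero[OF h tensor_space_zero] linear_on_zero[OF h' tensor_space_zero]
    by (simp del: zero_fun_apply)
next
  case (add c v w t)
  then show ?case
    by (simp add: linear_onD[OF h] linear_onD[OF h'] tensor_space_closed eq del: plus_fun_apply)
qed

text \<open>
  One argument at a time is moved from pure tensors to the whole tensor space. This carries both the
  Jacobi identity and the invariance of the form.
\<close>
lemma trilinear_tensor_space_zero:
  fixes s :: "'k::field \<Rightarrow> 'u::ab_group_add \<Rightarrow> 'u"
    and sV :: "'k \<Rightarrow> 'v::ab_group_add \<Rightarrow> 'v" and sW :: "'k \<Rightarrow> 'w::ab_group_add \<Rightarrow> 'w"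
    and V :: "'v set" and W :: "'w set"
  defines "T \<equiv> tensor_space sV V sW W" and "tn \<equiv> tensor sV V sW W"
  assumes s: "vector_space s"
    and lin1: "\<And>y z. y \<in> T \<Longrightarrow> z \<in> T \<Longrightarrow> linear_on fun_scale T s (\<lambda>x. h x y z)"
    and lin2: "\<And>x z. x \<in> T \<Longrightarrow> z \<in> T \<Longrightarrow> linear_on fun_scale T s (\<lambda>y. h x y z)"
    and lin3: "\<And>x y. x \<in> T \<Longrightarrow> y \<in> T \<Longrightarrow> linear_on fun_scale T s (\<lambda>z. h x y z)"
    and pure: "\<And>a1 a2 a3 b1 b2 b3. a1 \<in> V \<Longrightarrow> a2 \<in> V \<Longrightarrow> a3 \<in> V \<Longrightarrow> b1 \<in> W \<Longrightarrow> b2 \<in> W \<Longrightarrow> b3 \<in> W \<Longrightarrow>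
      h (tn a1 b1) (tn a2 b2) (tn a3 b3) = 0"
    and t: "x \<in> T" "y \<in> T" "z \<in> T"
  shows "h x y z = 0"
proof -
  interpret vector_space s by fact
  have 0: "linear_on fun_scale T s (\<lambda>_. 0)" by (simp add: linear_on_def)
  have tn: "tn a b \<in> T" if "a \<in> V" "b \<in> W" for a b
    using that by (simp add: T_def tn_def tensor_in_tensor_space)
  note eqI = linear_on_tensor_space_eq[where h' = "\<lambda>_. 0" and sV = sV and V = V and sW = sW and W = W,
      folded T_def tn_def, OF _ 0]
  have 1: "h x (tn a2 b2) (tn a3 b3) = 0" if "a2 \<in> V" "b2 \<in> W" "a3 \<in> V" "b3 \<in> W" for a2 b2 a3 b3
    by (rule eqI[OF lin1 _ t(1)]) (simp_all add: that tn pure)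
  have 2: "h x y (tn a3 b3) = 0" if "a3 \<in> V" "b3 \<in> W" for a3 b3
    by (rule eqI[OF lin2 _ t(2)]) (simp_all add: that tn t 1)
  show ?thesis
    by (rule eqI[OF lin3 _ t(3)]) (simp_all add: t 2)
qed

lemma tensor_space_eq_sum:
  assumes M: "fs.subspace M" "fs.subspace M'" "M \<subseteq> tensor_space sV V sW W" "M' \<subseteq> tensor_space sV V sW W"
    and split: "\<And>v w. v \<in> V \<Longrightarrow> w \<in> W \<Longrightarrow> \<exists>p\<in>M. \<exists>q\<in>M'. tensor sV V sW W v w = p + q"
  shows "tensor_space sV V sW W = {x + y | x y. x \<in> M \<and> y \<in> M'}"
proof
  show "tensor_space sV V sW W \<subseteq> {x + y | x y. x \<in> M \<and> y \<in> M'}"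
    unfolding tensor_space_def
    by (rule fs.span_minimal[OF _ fs.subspace_sums[OF M(1,2)]]) (use split in blast)
  show "{x + y | x y. x \<in> M \<and> y \<in> M'} \<subseteq> tensor_space sV V sW W"
    using M(3,4) tensor_space_add by blast
qed

text \<open>
  An element of the tensor space is a function on all maps \<open>V \<times> W \<rightarrow> k\<close>, with the default value
  zero off the bilinear ones; together with the next lemma this reduces equality of tensors to
  testing against bilinear forms.
\<close>
lemma tensor_space_outside:
  assumes "t \<in> tensor_space sV V sW W" "\<beta> \<notin> bilinear_forms sV V sW W"
  shows "t \<beta> = 0"
  using assms by (induction rule: tensor_space_induct) (auto simp: tensor_def fun_scale_def)

lemma tensor_space_eqI:
  assumes "t \<in> tensor_space sV V sW W" "t' \<in> tensor_space sV V sW W"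
    and "\<And>\<beta>. \<beta> \<in> bilinear_forms sV V sW W \<Longrightarrow> t \<beta> = t' \<beta>"
  shows "t = t'"
  using assms tensor_space_outside by (metis ext)

lemma tensor_space_sum:
  assumes t: "t \<in> tensor_space sV V sW W"
    and \<beta>: "\<And>i. i \<in> I \<Longrightarrow> \<beta> i \<in> bilinear_forms sV V sW W"
  shows "(\<lambda>v w. \<Sum>i\<in>I. \<beta> i v w) \<in> bilinear_forms sV V sW W \<and>
         t (\<lambda>v w. \<Sum>i\<in>I. \<beta> i v w) = (\<Sum>i\<in>I. t (\<beta> i))"
proof -
  have 0: "(\<lambda>v w. 0) \<in> bilinear_forms sV V sW W"
    by (auto simp: bilinear_forms_def bilinear_on_def linear_on_def)
  have "t (\<lambda>v w. 0) = 0"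
    using tensor_space_linear(4)[OF t 0 0, of 0] by simp
  then show ?thesis
    using \<beta> 0 tensor_space_linear(1,3)[OF t]
    by (induction I rule: infinite_finite_induct) auto
qed


section \<open>The tensor product of two bilinear forms\<close>

text \<open>
  For \<open>P = double_pairing\<close> this is \<open>double_form\<close>. Bilinearity, symmetry, nondegeneracy and
  invariance hold for any two factors with the corresponding properties.
\<close>
definition tensor_form ::
  "('v \<Rightarrow> 'v \<Rightarrow> 'k::field) \<Rightarrow> ('w \<Rightarrow> 'w \<Rightarrow> 'k) \<Rightarrow>
   (('v \<Rightarrow> 'w \<Rightarrow> 'k) \<Rightarrow> 'k) \<Rightarrow> (('v \<Rightarrow> 'w \<Rightarrow> 'k) \<Rightarrow> 'k) \<Rightarrow> 'k"
where
  "tensor_form P Q t t' = t (\<lambda>x b. t' (\<lambda>y c. P x y * Q b c))"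

context
  fixes sV :: "'k::field \<Rightarrow> 'v::ab_group_add \<Rightarrow> 'v" and V :: "'v set"
    and sW :: "'k \<Rightarrow> 'w::ab_group_add \<Rightarrow> 'w" and W :: "'w set"
    and P :: "'v \<Rightarrow> 'v \<Rightarrow> 'k" and Q :: "'w \<Rightarrow> 'w \<Rightarrow> 'k"
  assumes V: "vector_space sV" "module.subspace sV V"
    and W: "vector_space sW" "module.subspace sW W"
    and P: "bilinear_form_on sV V P" and Q: "bilinear_form_on sW W Q"
begin

interpretation V: vector_space sV by (rule V(1))
interpretation W: vector_space sW by (rule W(1))

lemma product_form_right:
  "x \<in> V \<Longrightarrow> b \<in> W \<Longrightarrow> (\<lambda>y c. P x y * Q b c) \<in> bilinear_forms sV V sW W"
  using P Q by (auto simp: bilinear_form_on_def bilinear_forms_def bilinear_on_def linear_on_def algebra_simps)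

lemma product_form_left:
  "y \<in> V \<Longrightarrow> c \<in> W \<Longrightarrow> (\<lambda>x b. P x y * Q b c) \<in> bilinear_forms sV V sW W"
  using P Q by (auto simp: bilinear_form_on_def bilinear_forms_def bilinear_on_def linear_on_def algebra_simps)

text \<open>
  The inner function of \<open>tensor_form\<close> has to be a genuine bilinear form, since otherwise the outer
  tensor would evaluate to its default value zero.
\<close>
lemma product_form_left_tensor_space:
  assumes t: "t \<in> tensor_space sV V sW W"
  shows "(\<lambda>x b. t (\<lambda>y c. P x y * Q b c)) \<in> bilinear_forms sV V sW W"
proof -
  have *: "t (\<lambda>y c. P (x + x') y * Q b c) = t (\<lambda>y c. P x y * Q b c) + t (\<lambda>y c. P x' y * Q b c)"
    if "x \<in> V" "x' \<in> V" "b \<in> W" for x x' b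
    unfolding tensor_space_linear(3)[OF t product_form_right product_form_right, OF that(1,3,2,3), symmetric]
    using P that
    by (intro tensor_space_cong[OF t] tensor_space_linear(1)[OF t] product_form_right V.subspace_add V)
       (auto simp: bilinear_form_on_def bilinear_on_def linear_on_def algebra_simps)
  have "t (\<lambda>y c. P (sV d x) y * Q b c) = d * t (\<lambda>y c. P x y * Q b c)"
    if "x \<in> V" "b \<in> W" for x b d
    unfolding tensor_space_linear(4)[OF t product_form_right[OF that] product_form_right[OF that], symmetric]
    using P that
    by (intro tensor_space_cong[OF t] tensor_space_linear(2)[OF t product_form_right[OF that] product_form_right[OF that]] product_form_right V.subspace_scale V)
       (auto simp: bilinear_form_on_def bilinear_on_def linear_on_def algebra_simps)
  moreover have "t (\<lambda>y c. P x y * Q (b + b') c) = t (\<lambda>y c. P x y * Q b c) + t (\<lambda>y c. P x y * Q b' c)"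
    if "x \<in> V" "b \<in> W" "b' \<in> W" for x b b'
    unfolding tensor_space_linear(3)[OF t product_form_right product_form_right, OF that(1,2,1,3), symmetric]
    using Q that
    by (intro tensor_space_cong[OF t] tensor_space_linear(1)[OF t] product_form_right W.subspace_add W)
       (auto simp: bilinear_form_on_def bilinear_on_def linear_on_def algebra_simps)
  moreover have "t (\<lambda>y c. P x y * Q (sW d b) c) = d * t (\<lambda>y c. P x y * Q b c)"
    if "x \<in> V" "b \<in> W" for x b d
    unfolding tensor_space_linear(4)[OF t product_form_right[OF that] product_form_right[OF that], symmetric]
    using Q that
    by (intro tensor_space_cong[OF t] tensor_space_linear(2)[OF t product_form_right[OF that] product_form_right[OF that]] product_form_right W.subspace_scale W)
       (auto simp: bilinear_form_on_def bilinear_on_def linear_on_def algebra_simps)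
  ultimately show ?thesis
    using * by (auto simp: bilinear_forms_def bilinear_on_def linear_on_def)
qed

lemma tensor_form_bilinear:
  "bilinear_form_on fun_scale (tensor_space sV V sW W) (tensor_form P Q)"
  unfolding bilinear_form_on_def bilinear_on_def linear_on_def tensor_form_def
  by (auto simp: fun_scale_def
      tensor_space_linear(3,4)[OF _ product_form_left_tensor_space product_form_left_tensor_space])

lemma tensor_form_tensor_right:
  assumes t: "t \<in> tensor_space sV V sW W" and "y \<in> V" "c \<in> W"
  shows "tensor_form P Q t (tensor sV V sW W y c) = t (\<lambda>x b. P x y * Q b c)"
  unfolding tensor_form_def using assms
  by (intro tensor_space_cong[OF t] product_form_left product_form_left_tensor_space tensor_in_tensor_space)
     (auto simp: tensor_def product_form_right)

lemma tensor_form_tensor: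
  assumes "x \<in> V" "b \<in> W" "y \<in> V" "c \<in> W"
  shows "tensor_form P Q (tensor sV V sW W x b) (tensor sV V sW W y c) = P x y * Q b c"
  using assms by (simp add: tensor_form_tensor_right tensor_in_tensor_space) (simp add: tensor_def product_form_left)

lemma tensor_form_symmetric:
  assumes "symmetric_on V P" "symmetric_on W Q"
  shows "symmetric_on (tensor_space sV V sW W) (tensor_form P Q)"
proof -
  note bil = tensor_form_bilinear[unfolded bilinear_form_on_def bilinear_on_def]
  let ?T = "tensor_space sV V sW W" and ?F = "tensor_form P Q"
  have pure: "?F t (tensor sV V sW W y c) = ?F (tensor sV V sW W y c) t"
    if t: "t \<in> ?T" and yc: "y \<in> V" "c \<in> W" for t y c
    by (rule linear_on_tensor_space_eq[OF _ _ _ t, where s = "(*)"])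
       (use bil assms yc in \<open>auto simp: tensor_in_tensor_space tensor_form_tensor symmetric_on_def\<close>)
  have "?F t t' = ?F t' t" if t: "t \<in> ?T" and t': "t' \<in> ?T" for t t'
    by (rule linear_on_tensor_space_eq[OF _ _ _ t', where s = "(*)"])
       (use bil t pure in auto)
  then show ?thesis by (auto simp: symmetric_on_def)
qed

text \<open>
  Expanding the second argument of a bilinear form \<open>\<beta>\<close> in the family \<open>e\<close>, and representing each
  functional \<open>\<beta>(-, e\<^sub>i)\<close> as \<open>P(-, y\<^sub>i)\<close>, gives \<open>\<beta> = \<Sum>\<^sub>i P(-, y\<^sub>i) Q(-, c\<^sub>i)\<close>. The value \<open>t \<beta>\<close> is then the
  sum of the pairings of \<open>t\<close> with the \<open>y\<^sub>i \<otimes> c\<^sub>i\<close>.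
\<close>
lemma tensor_form_nondegenerate:
  assumes rep: "\<And>h. linear_on sV V (*) h \<Longrightarrow> \<exists>y\<in>V. \<forall>x\<in>V. h x = P x y"
    and e: "\<And>i. i \<in> I \<Longrightarrow> e i \<in> W" and c: "\<And>i. i \<in> I \<Longrightarrow> c i \<in> W"
    and dual: "\<And>b. b \<in> W \<Longrightarrow> b = (\<Sum>i\<in>I. sW (Q b (c i)) (e i))"
  shows "nondegenerate_on (tensor_space sV V sW W) (tensor_form P Q)"
  unfolding nondegenerate_on_def
proof (intro ballI impI)
  fix t assume t: "t \<in> tensor_space sV V sW W"
    and rad: "\<forall>t'\<in>tensor_space sV V sW W. tensor_form P Q t t' = 0"
  have "t \<beta> = 0 \<beta>" if \<beta>: "\<beta> \<in> bilinear_forms sV V sW W" for \<beta>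
  proof -
    have "\<forall>i\<in>I. \<exists>y\<in>V. \<forall>x\<in>V. \<beta> x (e i) = P x y"
      using rep \<beta> e by (auto simp: bilinear_forms_def bilinear_on_def)
    then obtain y where y: "\<And>i. i \<in> I \<Longrightarrow> y i \<in> V" "\<And>i x. i \<in> I \<Longrightarrow> x \<in> V \<Longrightarrow> \<beta> x (e i) = P x (y i)"
      by metis
    have expand: "\<beta> x b = (\<Sum>i\<in>I. P x (y i) * Q b (c i))" if x: "x \<in> V" and b: "b \<in> W" for x b
    proof -
      have lin: "linear_on sW W (*) (\<beta> x)"
        using \<beta> x by (auto simp: bilinear_forms_def bilinear_on_def)
      have "\<beta> x b = \<beta> x (\<Sum>i\<in>I. sW (Q b (c i)) (e i))" using dual[OF b] by simp
      also have "\<dots> = (\<Sum>i\<in>I. \<beta> x (sW (Q b (c i)) (e i)))"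
        by (rule linear_on_sum[OF lin W]) (use e W in \<open>auto intro: W.subspace_scale\<close>)
      also have "\<dots> = (\<Sum>i\<in>I. P x (y i) * Q b (c i))"
        by (rule sum.cong) (auto simp: linear_onD(2)[OF lin] e y x)
      finally show ?thesis .
    qed
    have sums: "(\<lambda>x b. \<Sum>i\<in>I. P x (y i) * Q b (c i)) \<in> bilinear_forms sV V sW W \<and>
        t (\<lambda>x b. \<Sum>i\<in>I. P x (y i) * Q b (c i)) = (\<Sum>i\<in>I. t (\<lambda>x b. P x (y i) * Q b (c i)))"
      by (rule tensor_space_sum[OF t]) (auto intro: product_form_left y c)
    have "t \<beta> = t (\<lambda>x b. \<Sum>i\<in>I. P x (y i) * Q b (c i))"
      by (rule tensor_space_cong[OF t]) (use expand \<beta> sums in auto)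
    also have "\<dots> = (\<Sum>i\<in>I. tensor_form P Q t (tensor sV V sW W (y i) (c i)))"
      using sums by (simp add: tensor_form_tensor_right t y c)
    also have "\<dots> = 0"
      using rad y c by (intro sum.neutral) (auto simp: tensor_in_tensor_space)
    finally show ?thesis by simp
  qed
  then show "t = 0" by (rule tensor_space_eqI[OF t tensor_space_zero])
qed

end


section \<open>Representing linear functionals\<close>

lemma (in finite_dimensional_vector_space) linear_on_Basis:
  assumes h: "linear_on scale UNIV (*) h"
  shows "h b = (\<Sum>e\<in>Basis. representation Basis b e * h e)"
proof -
  have "h (\<Sum>e\<in>Basis. representation Basis b e *s e) = (\<Sum>e\<in>Basis. h (representation Basis b e *s e))"
    by (rule linear_on_sum[OF h vector_space_axioms]) auto
  moreover have "(\<Sum>e\<in>Basis. representation Basis b e *s e) = b"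
    by (rule sum_representation_eq) (auto simp: independent_Basis span_Basis finite_Basis)
  ultimately show ?thesis by (simp add: linear_onD(2)[OF h])
qed

lemma (in finite_dimensional_vector_space) linear_on_representation:
  "linear_on scale UNIV (*) (\<lambda>b. representation Basis b e)"
  by (auto simp: linear_on_def representation_add representation_scale independent_Basis span_Basis)

text \<open>
  Reading off the coordinates of \<open>Q(-, c)\<close> on the basis turns the map \<open>c \<mapsto> Q(-, c)\<close> into an
  endomorphism \<open>T\<close> of the space. Nondegeneracy makes \<open>T\<close> injective, hence surjective by finite
  dimension.
\<close>
lemma (in finite_dimensional_vector_space) nondegenerate_form_represents:
  assumes Q: "bilinear_form_on scale UNIV Q" and sym: "symmetric_on UNIV Q"
    and nondeg: "nondegenerate_on UNIV Q" and h: "linear_on scale UNIV (*) h"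
  shows "\<exists>c. \<forall>b. h b = Q b c"
proof -
  define T where "T c = (\<Sum>e\<in>Basis. Q e c *s e)" for c
  have coord: "u e = v e" if "(\<Sum>e\<in>Basis. u e *s e) = (\<Sum>e\<in>Basis. v e *s e)" "e \<in> Basis" for u v e
  proof -
    have "(\<Sum>e\<in>Basis. (u e - v e) *s e) = 0"
      using that(1) by (simp add: scale_left_diff_distrib sum_subtractf)
    then have "u e - v e = 0"
      by (rule independentD[OF independent_Basis finite_Basis order_refl _ that(2)])
    then show ?thesis by simp
  qed
  have lin: "linear_on scale UNIV (*) (\<lambda>b. Q b c)" for c
    using Q by (auto simp: bilinear_form_on_def bilinear_on_def)
  have ext: "f = g"
    if f: "linear_on scale UNIV (*) f" and g: "linear_on scale UNIV (*) g"
      and eq: "\<And>e. e \<in> Basis \<Longrightarrow> f e = g e" for f g :: "'b \<Rightarrow> 'a"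
  proof
    fix b
    show "f b = g b"
      using linear_on_Basis[OF f, of b] linear_on_Basis[OF g, of b] eq by (simp cong: sum.cong)
  qed
  have "Vector_Spaces.linear scale scale T"
    by unfold_locales
      (use Q in \<open>auto simp: T_def bilinear_form_on_def bilinear_on_def linear_on_def
         algebra_simps sum.distrib scale_sum_right\<close>)
  moreover have "inj T"
  proof (rule injI)
    fix c d assume "T c = T d"
    then have "Q e c = Q e d" if "e \<in> Basis" for e
      using coord[where u = "\<lambda>e. Q e c" and v = "\<lambda>e. Q e d"] that unfolding T_def by blast
    then have "(\<lambda>b. Q b c) = (\<lambda>b. Q b d)" by (intro ext lin)
    then have "Q b c = Q b d" for b by metis
    then have "Q c b = Q d b" for b using sym by (metis UNIV_I symmetric_on_def)
    moreover have "Q (c - d) b = Q c b - Q d b" for b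
      by (rule linear_on_diff[OF lin]) auto
    ultimately have "\<forall>b. Q (c - d) b = 0" by simp
    then have "c - d = 0" using nondeg by (auto simp: nondegenerate_on_def)
    then show "c = d" by simp
  qed
  ultimately have "surj T" by (rule linear_inj_imp_surj)
  then obtain c where "T c = (\<Sum>e\<in>Basis. h e *s e)" by (metis surjD)
  then have "h e = Q e c" if "e \<in> Basis" for e
    using coord[where u = "\<lambda>e. Q e c" and v = h] that unfolding T_def by metis
  then have "h = (\<lambda>b. Q b c)" by (intro ext h lin)
  then show ?thesis by metis
qed

lemma (in finite_dimensional_vector_space) nondegenerate_form_dual_basis:
  assumes Q: "bilinear_form_on scale UNIV Q" "symmetric_on UNIV Q" "nondegenerate_on UNIV Q"
  shows "\<exists>c. \<forall>b. b = (\<Sum>e\<in>Basis. Q b (c e) *s e)"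
proof -
  have "\<forall>e. \<exists>c. \<forall>b. representation Basis b e = Q b c"
    using nondegenerate_form_represents[OF Q linear_on_representation] by blast
  then obtain c where c: "\<And>e b. representation Basis b e = Q b (c e)" by metis
  have "(\<Sum>e\<in>Basis. Q b (c e) *s e) = b" for b
    unfolding c[symmetric]
    by (rule sum_representation_eq) (auto simp: independent_Basis span_Basis finite_Basis)
  then show ?thesis by metis
qed

lemma sum_fun_apply: "(\<Sum>i\<in>I. f i) x = (\<Sum>i\<in>I. f i x)"
  for f :: "'i \<Rightarrow> 'x \<Rightarrow> 'k::comm_monoid_add"
  by (induction I rule: infinite_finite_induct) auto

lemma dual_space_iff:
  assumes "vector_space sA"
  shows "f \<in> dual_space sA \<longleftrightarrow> linear_on sA UNIV (*) f"
proof -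
  interpret A: vector_space sA by fact
  interpret K: vector_space "(*) :: 'a \<Rightarrow> 'a \<Rightarrow> 'a" by unfold_locales (auto simp: algebra_simps)
  show ?thesis
    by (auto simp: dual_space_def linear_on_def Vector_Spaces.linear_iff
       A.vector_space_axioms K.vector_space_axioms)
qed

lemma subspace_dual_space:
  assumes "vector_space sA"
  shows "fs.subspace (dual_space sA)"
  by (auto simp: fs.subspace_def dual_space_iff[OF assms] linear_on_def fun_scale_def algebra_simps)

lemma double_scale_Pair:
  assumes "vector_space sA"
  shows "double_scale sA c (a, f) = (sA c a, fun_scale c f)"
proof -
  interpret vector_space sA by fact
  interpret vector_space_prod sA "fun_scale :: 'a \<Rightarrow> ('b \<Rightarrow> 'a) \<Rightarrow> _" ..
  show ?thesis by (simp add: double_scale_def scale_prod)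
qed

lemma double_space_vector_space:
  assumes "vector_space sA"
  shows "vector_space (double_scale sA)" "module.subspace (double_scale sA) (double_space sA)"
proof -
  interpret vector_space sA by fact
  interpret vector_space_prod sA "fun_scale :: 'a \<Rightarrow> ('b \<Rightarrow> 'a) \<Rightarrow> _" ..
  show "vector_space (double_scale sA)"
    unfolding double_scale_def by (rule p.vector_space_axioms)
  show "module.subspace (double_scale sA) (double_space sA)"
    unfolding double_scale_def double_space_def
    by (intro subspace_Times subspace_UNIV subspace_dual_space assms)
qed

lemma double_pairing_bilinear:
  assumes "vector_space sA"
  shows "bilinear_form_on (double_scale sA) (double_space sA) double_pairing"
  by (auto simp: bilinear_form_on_def bilinear_on_def linear_on_def double_space_def
      double_pairing_def double_scale_Pair[OF assms] dual_space_iff[OF assms] fun_scale_def algebra_simps)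

text \<open>
  A functional on \<open>A \<oplus> A\<^sup>*\<close> restricts to a functional \<open>f\<close> on \<open>A\<close>, which is already an element of
  \<open>A\<^sup>*\<close>, and to a functional on \<open>A\<^sup>*\<close>, which by reflexivity is evaluation at the vector \<open>a\<close> whose
  coordinates are its values on the dual basis.
\<close>
lemma double_pairing_represents:
  fixes sA :: "'k::field \<Rightarrow> 'a::ab_group_add \<Rightarrow> 'a"
  assumes "finite_dimensional_vector_space sA basA"
    and h: "linear_on (double_scale sA) (double_space sA) (*) h"
  shows "\<exists>y\<in>double_space sA. \<forall>x\<in>double_space sA. h x = double_pairing x y"
proof -
  interpret A: finite_dimensional_vector_space sA basA by fact
  note A = A.vector_space_axioms
  define coord where "coord e = (\<lambda>a. A.representation basA a e)" for e
  have coord: "coord e \<in> dual_space sA" for e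
    unfolding coord_def dual_space_iff[OF A] by (rule A.linear_on_representation)
  define a where "a = (\<Sum>e\<in>basA. sA (h (0, coord e)) e)"
  define f where "f = (\<lambda>a'. h (a', 0))"
  have zero: "0 \<in> dual_space sA" by (rule fs.subspace_0[OF subspace_dual_space[OF A]])
  have f: "f \<in> dual_space sA"
    unfolding dual_space_iff[OF A] linear_on_def f_def
    using linear_onD(1)[OF h, of "(x, 0)" "(x', 0)" for x x'] linear_onD(2)[OF h, of "(x, 0)" for x] zero
    by (simp add: double_space_def double_scale_Pair[OF A] fs.scale_zero_right)
  have h2: "linear_on fun_scale (dual_space sA) (*) (\<lambda>g. h (0, g))"
    unfolding linear_on_def
    using linear_onD(1)[OF h, of "(0, x)" "(0, x')" for x x'] linear_onD(2)[OF h, of "(0, x)" for x]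
    by (simp add: double_space_def double_scale_Pair[OF A] A.scale_zero_right)
  have ev: "h (0, g) = g a" if g: "g \<in> dual_space sA" for g
  proof -
    have lin: "linear_on sA UNIV (*) g" using g by (simp add: dual_space_iff[OF A])
    have "g = (\<Sum>e\<in>basA. fun_scale (g e) (coord e))"
    proof
      fix b
      show "g b = (\<Sum>e\<in>basA. fun_scale (g e) (coord e)) b"
        by (subst A.linear_on_Basis[OF lin]) (simp add: fun_scale_def coord_def sum_fun_apply mult.commute)
    qed
    then have "h (0, g) = h (0, \<Sum>e\<in>basA. fun_scale (g e) (coord e))" by simp
    also have "\<dots> = (\<Sum>e\<in>basA. h (0, fun_scale (g e) (coord e)))"
      by (rule linear_on_sum[OF h2 vector_space_fun_scale subspace_dual_space[OF A]])
         (intro fs.subspace_scale subspace_dual_space A coord)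
    also have "\<dots> = (\<Sum>e\<in>basA. g (sA (h (0, coord e)) e))"
      by (rule sum.cong) (auto simp: linear_onD(2)[OF h2 coord] linear_onD(2)[OF lin] mult.commute)
    also have "\<dots> = g a"
      unfolding a_def by (rule linear_on_sum[OF lin A, symmetric]) auto
    finally show ?thesis .
  qed
  have "h (a', g) = double_pairing (a', g) (a, f)" if g: "g \<in> dual_space sA" for a' g
  proof -
    have "h ((a', 0) + (0, g)) = h (a', 0) + h (0, g)"
      by (rule linear_onD(1)[OF h]) (use g zero in \<open>auto simp: double_space_def\<close>)
    then show ?thesis by (simp add: ev g double_pairing_def f_def)
  qed
  then show ?thesis
    using f by (intro bexI[of _ "(a, f)"]) (auto simp: double_space_def)
qed

section \<open>The induced Lie algebra\<close>

context
  fixes sV :: "'k::field \<Rightarrow> 'v::ab_group_add \<Rightarrow> 'v" and V :: "'v set"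
    and sW :: "'k \<Rightarrow> 'w::ab_group_add \<Rightarrow> 'w" and W :: "'w set"
    and circ :: "'v \<Rightarrow> 'v \<Rightarrow> 'v" and dia :: "'w \<Rightarrow> 'w \<Rightarrow> 'w"
  assumes A: "algebra_on sV V circ" and B: "algebra_on sW W dia"
begin

private abbreviation (input) "T \<equiv> tensor_space sV V sW W"
private abbreviation (input) "tn \<equiv> tensor sV V sW W"
private abbreviation (input) "br \<equiv> induced_bracket sV V sW W circ dia"

lemma algebra_closed: "x \<in> V \<Longrightarrow> y \<in> V \<Longrightarrow> circ x y \<in> V" "b \<in> W \<Longrightarrow> c \<in> W \<Longrightarrow> dia b c \<in> W"
  using A B by (auto simp: algebra_on_def)

lemmas bracket_bilinear = induced_bracket_bilinear[OF A B]

lemma bracket_linear_left: "y \<in> T \<Longrightarrow> linear_on fun_scale T fun_scale (\<lambda>x. br x y)"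
  and bracket_linear_right: "x \<in> T \<Longrightarrow> linear_on fun_scale T fun_scale (br x)"
  using bracket_bilinear by (auto simp: bilinear_on_def)

lemmas bracket_simps = bilinear_onD[OF bracket_bilinear]
  linear_on_diff[OF bracket_linear_left] linear_on_diff[OF bracket_linear_right]
  linear_on_zero[OF bracket_linear_left tensor_space_zero]
  linear_on_zero[OF bracket_linear_right tensor_space_zero]

lemmas bracket_tensor = induced_bracket_tensor[OF A B]

lemma bracket_tensor_closed: 
  assumes t: "t \<in> T" and a: "a \<in> V" "b \<in> W"
  shows "br (tn a b) t \<in> T"
  using t
proof (induction rule: tensor_space_induct)
  case zero
  show ?case using a by (simp add: bracket_simps tensor_space_closed del: zero_fun_apply)
next
  case (add c v w t)
  then show ?case
    using a by (simp add: bracket_simps tensor_space_closed bracket_tensor algebra_closed del: plus_fun_apply)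
qed

lemma bracket_closed:
  assumes t: "t \<in> T" and t': "t' \<in> T"
  shows "br t t' \<in> T"
  using t
proof (induction rule: tensor_space_induct)
  case zero
  show ?case using t' by (simp add: bracket_simps tensor_space_closed del: zero_fun_apply)
next
  case (add c v w t)
  then show ?case
    using t' by (simp add: bracket_simps tensor_space_closed bracket_tensor_closed del: plus_fun_apply)
qed

lemma bracket_antisym:
  assumes t: "t \<in> T" and t': "t' \<in> T"
  shows "br t t' = - br t' t"
proof -
  have lin_neg: "linear_on fun_scale T fun_scale (\<lambda>x. - h x)" if "linear_on fun_scale T fun_scale h" for h
    using that by (simp add: linear_on_def fs.scale_minus_right)
  have pure: "br t (tn a b) = - br (tn a b) t" if t: "t \<in> T" and ab: "a \<in> V" "b \<in> W" for t a b
    by (rule linear_on_tensor_space_eq[OF bracket_linear_left lin_neg[OF bracket_linear_right] _ t])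
       (simp_all add: ab tensor_space_closed bracket_tensor)
  show ?thesis
    by (rule linear_on_tensor_space_eq[OF bracket_linear_right lin_neg[OF bracket_linear_left] _ t'])
       (simp_all add: t pure)
qed

text \<open>
  Antisymmetry alone would give this only when \<open>2\<close> is invertible; induction over sums of pure
  tensors works over every field, with antisymmetry cancelling the cross terms.
\<close>
lemma bracket_self:
  assumes "t \<in> T"
  shows "br t t = 0"
  using assms
proof (induction rule: tensor_space_induct)
  case zero
  show ?case by (simp add: bracket_simps tensor_space_closed del: zero_fun_apply)
next
  case (add c v w t)
  have "br (tn v w) t = - br t (tn v w)"
    using add by (intro bracket_antisym tensor_space_closed)
  then show ?case
    using add by (simp add: bracket_simps tensor_space_closed bracket_tensor fs.scale_minus_right del: plus_fun_apply)
qed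

lemma jacobi_from_tensors:
  assumes pure: "\<And>a1 a2 a3 b1 b2 b3. a1 \<in> V \<Longrightarrow> a2 \<in> V \<Longrightarrow> a3 \<in> V \<Longrightarrow> b1 \<in> W \<Longrightarrow> b2 \<in> W \<Longrightarrow> b3 \<in> W \<Longrightarrow>
      br (tn a1 b1) (br (tn a2 b2) (tn a3 b3)) + br (tn a2 b2) (br (tn a3 b3) (tn a1 b1)) +
      br (tn a3 b3) (br (tn a1 b1) (tn a2 b2)) = 0"
    and t: "x \<in> T" "y \<in> T" "z \<in> T"
  shows "br x (br y z) + br y (br z x) + br z (br x y) = 0"
  by (rule trilinear_tensor_space_zero[where h = "\<lambda>x y z. br x (br y z) + br y (br z x) + br z (br x y)",
        OF vector_space_fun_scale _ _ _ pure t])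
     (simp_all add: linear_on_def bracket_simps bracket_closed tensor_space_closed
       fs.scale_right_distrib algebra_simps del: plus_fun_apply)

text \<open>
  On pure tensors put \<open>p = P x (y z)\<close>, \<open>q = P x (z y)\<close>, \<open>r = Q b (c d)\<close>, \<open>s = Q b (d c)\<close>. The
  hypotheses give \<open>P (x y) z = q\<close>, \<open>P (y x) z = - p - q\<close>, \<open>Q (b c) d = - r - s\<close> and \<open>Q (c b) d = r\<close>, so the
  left-hand side is \<open>q (- r - s) + (p + q) r = p r - q s\<close>, which is the right-hand side.
\<close>
lemma tensor_form_invariant:
  assumes P: "bilinear_form_on sV V P" "symmetric_on V P"
    and Q: "bilinear_form_on sW W Q" "symmetric_on W Q"
    and Pinv: "\<And>x y z. x \<in> V \<Longrightarrow> y \<in> V \<Longrightarrow> z \<in> V \<Longrightarrow> P (circ x y) z = - P y (circ x z + circ z x)"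
    and Qinv: "\<And>b c d. b \<in> W \<Longrightarrow> c \<in> W \<Longrightarrow> d \<in> W \<Longrightarrow> Q (dia b c) d = - Q b (dia c d + dia d c)"
    and t: "x \<in> T" "y \<in> T" "z \<in> T"
  shows "tensor_form P Q (br x y) z = tensor_form P Q x (br y z)"
proof -
  have V: "vector_space sV" "module.subspace sV V" and W: "vector_space sW" "module.subspace sW W"
    using A B by (auto simp: algebra_on_def)
  let ?F = "tensor_form P Q"
  note F = tensor_form_bilinear[OF V W P(1) Q(1), unfolded bilinear_form_on_def]
  have linF: "linear_on fun_scale T (*) (?F u)" "linear_on fun_scale T (*) (\<lambda>t. ?F t u)" if "u \<in> T" for u
    using F that by (auto simp: bilinear_on_def)
  note F_simps = bilinear_onD[OF F] linear_on_diff[OF linF(1)] linear_on_diff[OF linF(2)]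
  have K: "vector_space ((*) :: 'k \<Rightarrow> 'k \<Rightarrow> 'k)" by unfold_locales (auto simp: algebra_simps)
  have pure: "?F (br (tn x b) (tn y c)) (tn z d) - ?F (tn x b) (br (tn y c) (tn z d)) = 0"
    if v: "x \<in> V" "y \<in> V" "z \<in> V" and w: "b \<in> W" "c \<in> W" "d \<in> W" for x y z b c d
  proof -
    note closed = algebra_closed
    have addP: "P u (v + v') = P u v + P u v'" if "u \<in> V" "v \<in> V" "v' \<in> V" for u v v'
      using bilinear_onD(3)[OF P(1)[unfolded bilinear_form_on_def]] that by blast
    have addQ: "Q u (v + v') = Q u v + Q u v'" if "u \<in> W" "v \<in> W" "v' \<in> W" for u v v'
      using bilinear_onD(3)[OF Q(1)[unfolded bilinear_form_on_def]] that by blast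
    have P1: "P (circ u v) w = - P v (circ u w) - P v (circ w u)" if "u \<in> V" "v \<in> V" "w \<in> V" for u v w
      using Pinv that by (simp add: addP closed)
    have Q1: "Q (dia u v) w = - Q u (dia v w) - Q u (dia w v)" if "u \<in> W" "v \<in> W" "w \<in> W" for u v w
      using Qinv that by (simp add: addQ closed)
    have symP: "P u v = P v u" if "u \<in> V" "v \<in> V" for u v
      using P(2) that by (auto simp: symmetric_on_def)
    have symQ: "Q u v = Q v u" if "u \<in> W" "v \<in> W" for u v
      using Q(2) that by (auto simp: symmetric_on_def)
    \<comment> \<open>The six permuted instances of the identity, with symmetry, form a linear system
       from which this rule follows by elimination; likewise for \<open>Q\<close>.\<close>
    have "P (circ x y) z = P x (circ z y)"
      using P1[OF v(1,2,3)] P1[OF v(2,1,3)] P1[OF v(3,1,2)] P1[OF v(3,2,1)] P1[OF v(2,3,1)] P1[OF v(1,3,2)]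
        symP v closed by (simp add: closed)
    moreover have "Q (dia c b) d = Q b (dia c d)"
      using Q1[OF w(1,2,3)] Q1[OF w(2,1,3)] Q1[OF w(3,1,2)] Q1[OF w(3,2,1)] Q1[OF w(2,3,1)] Q1[OF w(1,3,2)]
        symQ w closed by (simp add: closed)
    ultimately show ?thesis
      using v w
      by (simp add: bracket_tensor F_simps tensor_space_closed closed tensor_form_tensor[OF V W P(1) Q(1)]
          P1[OF v(2,1,3)] Q1[OF w] algebra_simps del: minus_apply)
  qed
  have "?F (br x y) z - ?F x (br y z) = 0"
    by (rule trilinear_tensor_space_zero[where h = "\<lambda>x y z. ?F (br x y) z - ?F x (br y z)",
          OF K _ _ _ pure t])
       (simp_all add: linear_on_def bracket_simps F_simps bracket_closed tensor_space_closed
         algebra_simps del: plus_fun_apply)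
  then show ?thesis by simp
qed

end

text \<open>
  In the variables \<open>u, p, v, q\<close> the term \<open>[x\<^sub>1, [x\<^sub>2, x\<^sub>3]]\<close> becomes
  \<open>(u\<^sub>1 + p\<^sub>3) \<otimes> v\<^sub>3 - u\<^sub>2 \<otimes> (v\<^sub>1 + q\<^sub>2) - (u\<^sub>1 + p\<^sub>2) \<otimes> v\<^sub>2 + u\<^sub>3 \<otimes> (v\<^sub>1 + q\<^sub>3)\<close>.
  In the cyclic sum the terms \<open>p\<^sub>k \<otimes> v\<^sub>k\<close> and \<open>u\<^sub>i \<otimes> q\<^sub>i\<close> cancel telescopically, and each
  \<open>u\<^sub>i \<otimes> v\<^sub>k\<close> with \<open>i \<noteq> k\<close> occurs once with each sign.
\<close>
lemma induced_lie_algebra: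
  assumes V: "novikov_algebra sV V circ" and W: "right_novikov_algebra sW W dia"
  shows "lie_algebra fun_scale (tensor_space sV V sW W) (induced_bracket sV V sW W circ dia)"
proof -
  have A: "algebra_on sV V circ" and B: "algebra_on sW W dia"
    using V W by (auto simp: novikov_algebra_def right_novikov_algebra_def)
  let ?tn = "tensor sV V sW W" and ?br = "induced_bracket sV V sW W circ dia"
  have Vc: "circ x y \<in> V" if "x \<in> V" "y \<in> V" for x y using A that by (auto simp: algebra_on_def)
  have Wc: "dia x y \<in> W" if "x \<in> W" "y \<in> W" for x y using B that by (auto simp: algebra_on_def)
  have Vs: "x + y \<in> V" "x - y \<in> V" if "x \<in> V" "y \<in> V" for x y
    using A that unfolding algebra_on_def
    by (metis module.subspace_add module.subspace_diff module_iff_vector_space)+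
  have Ws: "x + y \<in> W" "x - y \<in> W" if "x \<in> W" "y \<in> W" for x y
    using B that unfolding algebra_on_def
    by (metis module.subspace_add module.subspace_diff module_iff_vector_space)+
  have tadd: "?tn (x + y) b = ?tn x b + ?tn y b" if "x \<in> V" "y \<in> V" "b \<in> W" for x y b
    using bilinear_onD(1)[OF tensor_bilinear] that by blast
  have tadd': "?tn x (b + c) = ?tn x b + ?tn x c" if "x \<in> V" "b \<in> W" "c \<in> W" for x b c
    using bilinear_onD(3)[OF tensor_bilinear] that by blast
  have jac: "?br (?tn a1 b1) (?br (?tn a2 b2) (?tn a3 b3)) + ?br (?tn a2 b2) (?br (?tn a3 b3) (?tn a1 b1)) +
     ?br (?tn a3 b3) (?br (?tn a1 b1) (?tn a2 b2)) = 0"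
    if a: "a1 \<in> V" "a2 \<in> V" "a3 \<in> V" and b: "b1 \<in> W" "b2 \<in> W" "b3 \<in> W" for a1 a2 a3 b1 b2 b3
  proof -
    define u1 u2 u3 where "u1 = circ (circ a1 a2) a3" and "u2 = circ (circ a2 a3) a1"
      and "u3 = circ (circ a3 a1) a2"
    define p1 p2 p3 where "p1 = circ a2 (circ a3 a1) - u2" and "p2 = circ a3 (circ a1 a2) - u3"
      and "p3 = circ a1 (circ a2 a3) - u1"
    define v1 v2 v3 where "v1 = dia b2 (dia b3 b1)" and "v2 = dia b3 (dia b1 b2)"
      and "v3 = dia b1 (dia b2 b3)"
    define q1 q2 q3 where "q1 = dia (dia b1 b2) b3 - v3" and "q2 = dia (dia b2 b3) b1 - v1"
      and "q3 = dia (dia b3 b1) b2 - v2"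
    have mem: "u1 \<in> V" "u2 \<in> V" "u3 \<in> V" "p1 \<in> V" "p2 \<in> V" "p3 \<in> V"
       "v1 \<in> W" "v2 \<in> W" "v3 \<in> W" "q1 \<in> W" "q2 \<in> W" "q3 \<in> W"
      using a b Vc Wc Vs Ws
      by (auto simp: u1_def u2_def u3_def p1_def p2_def p3_def v1_def v2_def v3_def q1_def q2_def q3_def)
    have rc: "circ (circ x y) z = circ (circ x z) y"
      and ls: "circ (circ x y) z - circ x (circ y z) = circ (circ y x) z - circ y (circ x z)"
      if "x \<in> V" "y \<in> V" "z \<in> V" for x y z
      using V that unfolding novikov_algebra_def by blast+
    have lc: "dia x (dia y z) = dia y (dia x z)"
      and rs: "dia (dia x y) z - dia x (dia y z) = dia (dia x z) y - dia x (dia z y)"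
      if "x \<in> W" "y \<in> W" "z \<in> W" for x y z
      using W that unfolding right_novikov_algebra_def by blast+
    have "circ (circ a1 a2) a3 = u1" "circ (circ a1 a3) a2 = u1"
      "circ (circ a2 a3) a1 = u2" "circ (circ a2 a1) a3 = u2"
      "circ (circ a3 a1) a2 = u3" "circ (circ a3 a2) a1 = u3"
      using rc a by (auto simp: u1_def u2_def u3_def)
    note us = this
    have ps: "circ a1 (circ a2 a3) = u1 + p3" "circ a2 (circ a1 a3) = u2 + p3"
      "circ a2 (circ a3 a1) = u2 + p1" "circ a3 (circ a2 a1) = u3 + p1"
      "circ a3 (circ a1 a2) = u3 + p2" "circ a1 (circ a3 a2) = u1 + p2"
      using ls[OF a(1,2,3)] ls[OF a(2,3,1)] ls[OF a(3,1,2)]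
      unfolding us by (auto simp: p1_def p2_def p3_def algebra_simps)
    have "dia b1 (dia b2 b3) = v3" "dia b2 (dia b1 b3) = v3"
      "dia b2 (dia b3 b1) = v1" "dia b3 (dia b2 b1) = v1"
      "dia b3 (dia b1 b2) = v2" "dia b1 (dia b3 b2) = v2"
      using lc b by (auto simp: v1_def v2_def v3_def)
    note vs = this
    have qs: "dia (dia b1 b2) b3 = v3 + q1" "dia (dia b1 b3) b2 = v2 + q1"
      "dia (dia b2 b3) b1 = v1 + q2" "dia (dia b2 b1) b3 = v3 + q2"
      "dia (dia b3 b1) b2 = v2 + q3" "dia (dia b3 b2) b1 = v1 + q3"
      using rs[OF b(1,2,3)] rs[OF b(2,3,1)] rs[OF b(3,1,2)]
      unfolding vs by (auto simp: q1_def q2_def q3_def algebra_simps)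
    have nested: "?br (?tn x b) (?br (?tn y c) (?tn z d)) =
       ?tn (circ x (circ y z)) (dia b (dia c d)) - ?tn (circ (circ y z) x) (dia (dia c d) b)
       - (?tn (circ x (circ z y)) (dia b (dia d c)) - ?tn (circ (circ z y) x) (dia (dia d c) b))"
      if "x \<in> V" "y \<in> V" "z \<in> V" "b \<in> W" "c \<in> W" "d \<in> W" for x y z b c d
      using that
      by (simp add: induced_bracket_tensor[OF A B] linear_on_diff[OF bracket_linear_right[OF A B]]
          Vc Wc tensor_space_closed del: minus_apply)
    show ?thesis
      using a b by (simp add: nested us ps vs qs tadd tadd' mem Vs Ws algebra_simps del: plus_fun_apply minus_apply)
  qed
  show ?thesis
    unfolding lie_algebra_def algebra_on_def
    using vector_space_fun_scale subspace_tensor_space bracket_closed[OF A B] induced_bracket_bilinear[OF A B]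
      bracket_self[OF A B] jacobi_from_tensors[OF A B jac]
    by blast
qed

section \<open>Functoriality of the induced Lie algebra\<close>

lemma tensor_map_linear: "linear_on fun_scale S fun_scale (tensor_map sV' V' sW W j)"
  by (auto simp: linear_on_def tensor_map_def fun_scale_def fun_eq_iff)

lemma tensor_map_in_tensor_space:
  assumes j: "linear_on sV V sV' j" "j ` V \<subseteq> V'" and t: "t \<in> tensor_space sV V sW W"
  shows "tensor_map sV' V' sW W j t \<in> tensor_space sV' V' sW W"
  using t
proof (induction rule: tensor_space_induct)
  case zero
  have "tensor_map sV' V' sW W j 0 = 0"
    by (rule linear_on_zero[OF tensor_map_linear[where S = UNIV] UNIV_I])
  then show ?case by (simp add: tensor_space_zero del: zero_fun_apply)
next
  case (add c v w t)
  then have "tensor sV' V' sW W (j v) w \<in> tensor_space sV' V' sW W"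
    using j(2) by (auto intro: tensor_in_tensor_space)
  with add show ?case
    by (simp add: linear_onD[OF tensor_map_linear[where S = UNIV]] tensor_map_tensor[OF j] tensor_space_closed
        del: plus_fun_apply)
qed

text \<open>
  The retraction \<open>r\<close> pulls a bilinear form \<open>\<beta>\<close> on \<open>V \<times> W\<close> back to one on \<open>V' \<times> W\<close>, and evaluating the
  image of \<open>t\<close> on it recovers \<open>t \<beta>\<close>.
\<close>
lemma tensor_map_inj:
  assumes j: "linear_on sV V sV' j" "j ` V \<subseteq> V'"
    and r: "linear_on sV' V' sV r" "r ` V' \<subseteq> V" and rj: "\<And>v. v \<in> V \<Longrightarrow> r (j v) = v"
  shows "inj_on (tensor_map sV' V' sW W j) (tensor_space sV V sW W)"
proof (rule inj_onI)
  let ?T = "tensor_space sV V sW W"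
  fix t t' assume t: "t \<in> ?T" "t' \<in> ?T"
    and eq: "tensor_map sV' V' sW W j t = tensor_map sV' V' sW W j t'"
  show "t = t'"
  proof (rule tensor_space_eqI[OF t])
    fix \<beta> assume \<beta>: "\<beta> \<in> bilinear_forms sV V sW W"
    have \<beta>': "(\<lambda>x w. \<beta> (r x) w) \<in> bilinear_forms sV' V' sW W"
      using \<beta> r by (force simp: bilinear_forms_def bilinear_on_def linear_on_def image_subset_iff)
    have \<beta>'': "(\<lambda>v w. \<beta> (r (j v)) w) \<in> bilinear_forms sV V sW W"
      using \<beta>' j by (force simp: bilinear_forms_def bilinear_on_def linear_on_def image_subset_iff)
    have ret: "u \<beta> = tensor_map sV' V' sW W j u (\<lambda>x w. \<beta> (r x) w)" if u: "u \<in> ?T" for u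
      using \<beta>' tensor_space_cong[OF u _ \<beta> \<beta>''] rj by (simp add: tensor_map_def)
    show "t \<beta> = t' \<beta>" by (simp only: ret[OF t(1)] ret[OF t(2)] eq)
  qed
qed

lemma tensor_map_isotropic:
  assumes V': "vector_space sV'" "module.subspace sV' V'"
    and W: "vector_space sW" "module.subspace sW W"
    and P: "bilinear_form_on sV' V' P" and Q: "bilinear_form_on sW W Q"
    and j: "linear_on sV V sV' j" "j ` V \<subseteq> V'"
    and iso: "\<And>v v'. v \<in> V \<Longrightarrow> v' \<in> V \<Longrightarrow> P (j v) (j v') = 0"
    and t: "t \<in> tensor_space sV V sW W" "t' \<in> tensor_space sV V sW W"
  shows "tensor_form P Q (tensor_map sV' V' sW W j t) (tensor_map sV' V' sW W j t') = 0"
proof -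
  let ?T = "tensor_space sV V sW W" and ?T' = "tensor_space sV' V' sW W"
  let ?F = "tensor_form P Q" and ?m = "tensor_map sV' V' sW W j" and ?tn = "tensor sV V sW W"
  note F = bilinear_onD[OF tensor_form_bilinear[OF V' W P Q, unfolded bilinear_form_on_def]]
  note m = linear_onD[OF tensor_map_linear[where S = UNIV]] tensor_map_in_tensor_space[OF j]
  have linl: "linear_on fun_scale ?T (*) (\<lambda>t. ?F (?m t) u)" if "u \<in> ?T'" for u
    using that by (simp add: linear_on_def F m tensor_space_closed del: plus_fun_apply)
  have linr: "linear_on fun_scale ?T (*) (\<lambda>t. ?F u (?m t))" if "u \<in> ?T'" for u
    using that by (simp add: linear_on_def F m tensor_space_closed del: plus_fun_apply)
  have 0: "linear_on fun_scale ?T (*) (\<lambda>_. 0)" by (simp add: linear_on_def)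
  have jV: "j v \<in> V'" if "v \<in> V" for v using j(2) that by auto
  have 1: "?F (?m t) (?m (?tn v w)) = 0" if "v \<in> V" "w \<in> W" for v w
    by (rule linear_on_tensor_space_eq[OF linl 0 _ t(1)])
       (simp_all add: that m tensor_space_closed tensor_map_tensor[OF j] tensor_form_tensor[OF V' W P Q] iso jV)
  show ?thesis
    by (rule linear_on_tensor_space_eq[OF linr 0 _ t(2)]) (simp_all add: t m 1)
qed

lemma tensor_map_lie_algebra_embedding:
  assumes N: "novikov_algebra sV V circ" and N': "novikov_algebra sV' V' circ'"
    and R: "right_novikov_algebra sW W dia"
    and j: "linear_on sV V sV' j" "j ` V \<subseteq> V'"
    and r: "linear_on sV' V' sV r" "r ` V' \<subseteq> V" and rj: "\<And>v. v \<in> V \<Longrightarrow> r (j v) = v"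
    and hom: "\<And>x y. x \<in> V \<Longrightarrow> y \<in> V \<Longrightarrow> j (circ x y) = circ' (j x) (j y)"
  shows "lie_algebra_embedding
      fun_scale (tensor_space sV V sW W) (induced_bracket sV V sW W circ dia)
      fun_scale (tensor_space sV' V' sW W) (induced_bracket sV' V' sW W circ' dia)
      (tensor_map sV' V' sW W j)"
proof -
  let ?T = "tensor_space sV V sW W" and ?T' = "tensor_space sV' V' sW W"
  let ?m = "tensor_map sV' V' sW W j" and ?tn = "tensor sV V sW W"
  let ?br = "induced_bracket sV V sW W circ dia" and ?br' = "induced_bracket sV' V' sW W circ' dia"
  have A: "algebra_on sV V circ" and A': "algebra_on sV' V' circ'" and B: "algebra_on sW W dia"
    using N N' R by (auto simp: novikov_algebra_def right_novikov_algebra_def)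
  note m = linear_onD[OF tensor_map_linear[where S = UNIV]] tensor_map_in_tensor_space[OF j]
    linear_on_diff[OF tensor_map_linear[where S = UNIV]]
  note closed = bracket_closed[OF A B] bracket_closed[OF A' B] tensor_space_closed algebra_closed[OF A B]
  have jV: "j v \<in> V'" if "v \<in> V" for v using j(2) that by auto
  have lin: "linear_on fun_scale ?T fun_scale (\<lambda>t. ?m (?br t u))"
     "linear_on fun_scale ?T fun_scale (\<lambda>t. ?m (?br u t))"
     "linear_on fun_scale ?T fun_scale (\<lambda>t. ?br' (?m t) (?m u))"
     "linear_on fun_scale ?T fun_scale (\<lambda>t. ?br' (?m u) (?m t))" if "u \<in> ?T" for u
    using that
    by (simp_all add: linear_on_def bilinear_onD[OF induced_bracket_bilinear[OF A B]]
        bilinear_onD[OF induced_bracket_bilinear[OF A' B]] m closed del: plus_fun_apply)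
  have 1: "?m (?br t (?tn v w)) = ?br' (?m t) (?m (?tn v w))" if t: "t \<in> ?T" and vw: "v \<in> V" "w \<in> W" for t v w
    by (rule linear_on_tensor_space_eq[OF lin(1) lin(3) _ t])
       (simp_all add: vw closed induced_bracket_tensor[OF A B] induced_bracket_tensor[OF A' B] m
          tensor_map_tensor[OF j] hom jV del: minus_apply)
  have "?m (?br t t') = ?br' (?m t) (?m t')" if t: "t \<in> ?T" and t': "t' \<in> ?T" for t t'
    by (rule linear_on_tensor_space_eq[OF lin(2) lin(4) _ t']) (simp_all add: t 1)
  then show ?thesis
    unfolding lie_algebra_embedding_def
    using induced_lie_algebra[OF N R] induced_lie_algebra[OF N' R] tensor_map_linear
      tensor_map_inj[OF j r rj] m(3) by blast
qed

lemma lie_algebra_embedding_image: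
  assumes "lie_algebra_embedding s1 L1 br1 s2 L2 br2 h"
  shows "lie_subalgebra s2 L2 br2 (h ` L1)"
proof -
  have L1: "vector_space s1" "module.subspace s1 L1" "\<And>x y. x \<in> L1 \<Longrightarrow> y \<in> L1 \<Longrightarrow> br1 x y \<in> L1"
    and s2: "vector_space s2" and h: "linear_on s1 L1 s2 h" "h ` L1 \<subseteq> L2"
      "\<And>x y. x \<in> L1 \<Longrightarrow> y \<in> L1 \<Longrightarrow> br2 (h x) (h y) = h (br1 x y)"
    using assms by (auto simp: lie_algebra_embedding_def lie_algebra_def algebra_on_def)
  interpret L1: vector_space s1 by fact
  interpret L2: vector_space s2 by fact
  have "L2.subspace (h ` L1)"
  proof (rule L2.subspaceI)
    show "0 \<in> h ` L1"
      using linear_on_zero[OF h(1)] L1.subspace_0[OF L1(2)] by (metis imageI)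
  next
    fix x y assume "x \<in> h ` L1" "y \<in> h ` L1"
    then show "x + y \<in> h ` L1"
      using linear_onD(1)[OF h(1)] L1.subspace_add[OF L1(2)] by (metis (no_types, lifting) imageE imageI)
  next
    fix c x assume "x \<in> h ` L1"
    then show "s2 c x \<in> h ` L1"
      using linear_onD(2)[OF h(1)] L1.subspace_scale[OF L1(2)] by (metis (no_types, lifting) imageE imageI)
  qed
  then show ?thesis using h L1(3) by (auto simp: lie_subalgebra_def)
qed

theorem proposition3p16:
  fixes sA :: "'k::field_char_0 \<Rightarrow> 'a::ab_group_add \<Rightarrow> 'a" and basA :: "'a set"
    and sB :: "'k \<Rightarrow> 'b::ab_group_add \<Rightarrow> 'b" and basB :: "'b set"
    and dia :: "'b \<Rightarrow> 'b \<Rightarrow> 'b" and form :: "'b \<Rightarrow> 'b \<Rightarrow> 'k"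
    and circ :: "'a \<Rightarrow> 'a \<Rightarrow> 'a"
    and bul :: "('a \<Rightarrow> 'k) \<Rightarrow> ('a \<Rightarrow> 'k) \<Rightarrow> ('a \<Rightarrow> 'k)"
    and mul :: "'a \<times> ('a \<Rightarrow> 'k) \<Rightarrow> 'a \<times> ('a \<Rightarrow> 'k) \<Rightarrow> 'a \<times> ('a \<Rightarrow> 'k)"
  assumes "finite_dimensional_vector_space sB basB"
    and "quadratic_right_novikov_algebra sB UNIV dia form"
    and "finite_dimensional_vector_space sA basA"
    and "novikov_algebra sA UNIV circ"
    and "novikov_algebra fun_scale (dual_space sA) bul"
    and "manin_triple_novikov sA circ bul mul"
  shows
    "let AB = tensor_space sA UNIV sB UNIV;
         brAB = induced_bracket sA UNIV sB UNIV circ dia;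
         A'B = tensor_space fun_scale (dual_space sA) sB UNIV;
         brA'B = induced_bracket fun_scale (dual_space sA) sB UNIV bul dia;
         tn = tensor (double_scale sA) (double_space sA) sB UNIV;
         L = tensor_space (double_scale sA) (double_space sA) sB UNIV;
         brL = induced_bracket (double_scale sA) (double_space sA) sB UNIV mul dia;
         inA = tensor_map (double_scale sA) (double_space sA) sB UNIV (\<lambda>a. (a, 0));
         inA' = tensor_map (double_scale sA) (double_space sA) sB UNIV (\<lambda>f. (0, f));
         formL = double_form form
     in lie_algebra_embedding fun_scale AB brAB fun_scale L brL inA \<and>
        lie_algebra_embedding fun_scale A'B brA'B fun_scale L brL inA' \<and>
        (\<forall>a1 a2. \<forall>f\<in>dual_space sA. \<forall>g\<in>dual_space sA. \<forall>b1 b2 b3 b4.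
           formL (tn (a1, 0) b1 + tn (0, f) b2) (tn (a2, 0) b3 + tn (0, g) b4)
             = f a2 * form b2 b3 + g a1 * form b1 b4) \<and>
        manin_triple_lie fun_scale L brL (inA ` AB) (inA' ` A'B) formL"
proof -
  let ?V = "double_space sA" and ?sV = "double_scale sA"
  let ?A' = "dual_space sA"
  interpret A: finite_dimensional_vector_space sA basA by fact
  interpret B: finite_dimensional_vector_space sB basB by fact
  note A = A.vector_space_axioms and B = B.vector_space_axioms
  note V = double_space_vector_space[OF A]
  have R: "right_novikov_algebra sB UNIV dia" and Q: "bilinear_form_on sB UNIV form"
    "symmetric_on UNIV form" "nondegenerate_on UNIV form"
    and Qinv: "\<And>b c d. form (dia b c) d = - form b (dia c d + dia d c)"
    using assms(2) by (auto simp: quadratic_right_novikov_algebra_def)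
  have N: "novikov_algebra ?sV ?V mul"
    and mulA: "\<And>a b. mul (a, 0) (b, 0) = (circ a b, 0)"
    and mulA': "\<And>f g. f \<in> ?A' \<Longrightarrow> g \<in> ?A' \<Longrightarrow> mul (0, f) (0, g) = (0, bul f g)"
    and Pinv: "\<And>x y z. x \<in> ?V \<Longrightarrow> y \<in> ?V \<Longrightarrow> z \<in> ?V \<Longrightarrow>
        double_pairing (mul x y) z = - double_pairing y (mul x z + mul z x)"
    using assms(6) unfolding manin_triple_novikov_def by blast+
  have AV: "algebra_on ?sV ?V mul" and AB: "algebra_on sB UNIV dia"
    using N R by (auto simp: novikov_algebra_def right_novikov_algebra_def)
  note P = double_pairing_bilinear[OF A]
  have Psym: "symmetric_on ?V double_pairing" by (auto simp: symmetric_on_def double_pairing_def)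
  have UB: "module.subspace sB UNIV" by simp
  have dual0: "0 \<in> ?A'" by (rule fs.subspace_0[OF subspace_dual_space[OF A]])
  define inA where "inA = tensor_map ?sV ?V sB UNIV (\<lambda>a. (a, 0 :: 'a \<Rightarrow> 'k))"
  define inA' where "inA' = tensor_map ?sV ?V sB UNIV (\<lambda>f :: 'a \<Rightarrow> 'k. (0 :: 'a, f))"
  let ?AB = "tensor_space sA UNIV sB UNIV" and ?brAB = "induced_bracket sA UNIV sB UNIV circ dia"
  let ?A'B = "tensor_space fun_scale ?A' sB UNIV" and ?brA'B = "induced_bracket fun_scale ?A' sB UNIV bul dia"
  let ?L = "tensor_space ?sV ?V sB UNIV" and ?brL = "induced_bracket ?sV ?V sB UNIV mul dia"
  let ?tn = "tensor ?sV ?V sB UNIV" and ?F = "double_form form"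
  have F: "?F = tensor_form double_pairing form"
    by (simp add: fun_eq_iff double_form_def tensor_form_def)
  have jA: "linear_on sA UNIV ?sV (\<lambda>a. (a, 0))" "range (\<lambda>a. (a, 0)) \<subseteq> ?V"
    using dual0 by (auto simp: linear_on_def double_scale_Pair[OF A] double_space_def fs.scale_zero_right
       simp del: zero_fun_apply)
  have jA': "linear_on fun_scale ?A' ?sV (\<lambda>f. (0, f))" "(\<lambda>f. (0, f)) ` ?A' \<subseteq> ?V"
    by (auto simp: linear_on_def double_scale_Pair[OF A] double_space_def)
  have embA: "lie_algebra_embedding fun_scale ?AB ?brAB fun_scale ?L ?brL inA"
    unfolding inA_def
    by (rule tensor_map_lie_algebra_embedding[OF assms(4) N R jA, where r = fst])
       (auto simp: linear_on_def double_scale_Pair[OF A] mulA double_space_def)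
  have embA': "lie_algebra_embedding fun_scale ?A'B ?brA'B fun_scale ?L ?brL inA'"
    unfolding inA'_def
    by (rule tensor_map_lie_algebra_embedding[OF assms(5) N R jA', where r = snd])
       (auto simp: linear_on_def double_scale_Pair[OF A] mulA' double_space_def)
  note subA = lie_algebra_embedding_image[OF embA] and subA' = lie_algebra_embedding_image[OF embA']
  note Fbil = tensor_form_bilinear[OF V B UB P Q(1), folded F]
  note Fsimps = bilinear_onD[OF Fbil[unfolded bilinear_form_on_def]]
  note Ftn = tensor_form_tensor[OF V B UB P Q(1), folded F]
  have formula: "?F (?tn (a1, 0) b1 + ?tn (0, f) b2) (?tn (a2, 0) b3 + ?tn (0, g) b4)
      = f a2 * form b2 b3 + g a1 * form b1 b4" if fg: "f \<in> ?A'" "g \<in> ?A'" for a1 a2 f g b1 b2 b3 b4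
  proof -
    have lin: "f 0 = 0" "g 0 = 0"
      using fg linear_on_zero[OF _ UNIV_I] by (auto simp: dual_space_iff[OF A])
    have mem: "(a, 0) \<in> ?V" "(0, f) \<in> ?V" "(0, g) \<in> ?V" for a
      using fg dual0 by (auto simp: double_space_def)
    show ?thesis
      by (simp add: Fsimps Ftn mem tensor_space_closed double_pairing_def lin del: plus_fun_apply)
  qed
  have subs: "fs.subspace (inA ` ?AB)" "inA ` ?AB \<subseteq> ?L" "fs.subspace (inA' ` ?A'B)" "inA' ` ?A'B \<subseteq> ?L"
    using subA subA' unfolding lie_subalgebra_def by blast+
  have sum: "?L = {x + y | x y. x \<in> inA ` ?AB \<and> y \<in> inA' ` ?A'B}"
  proof (rule tensor_space_eq_sum[OF subs(1,3,2,4)])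
    fix v :: "'a \<times> ('a \<Rightarrow> 'k)" and w :: 'b assume "v \<in> ?V"
    then obtain a f where v: "v = (a, f)" and f: "f \<in> ?A'" by (auto simp: double_space_def)
    have "?tn ((a, 0) + (0, f)) w = ?tn (a, 0) w + ?tn (0, f) w"
      by (rule bilinear_onD(1)[OF tensor_bilinear]) (use f dual0 in \<open>auto simp: double_space_def\<close>)
    then have "?tn v w = inA (tensor sA UNIV sB UNIV a w) + inA' (tensor fun_scale ?A' sB UNIV f w)"
      by (simp add: v inA_def inA'_def tensor_map_tensor[OF jA] tensor_map_tensor[OF jA'])
    moreover have "inA (tensor sA UNIV sB UNIV a w) \<in> inA ` ?AB"
      "inA' (tensor fun_scale ?A' sB UNIV f w) \<in> inA' ` ?A'B"
      by (intro imageI tensor_in_tensor_space UNIV_I f)+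
    ultimately show "\<exists>p\<in>inA ` ?AB. \<exists>q\<in>inA' ` ?A'B. ?tn v w = p + q" by blast
  qed
  have isoA: "\<forall>x\<in>inA ` ?AB. \<forall>y\<in>inA ` ?AB. ?F x y = 0"
    unfolding F inA_def
    by (auto intro!: tensor_map_isotropic[OF V B UB P Q(1) jA] simp: double_pairing_def)
  have lin0: "f 0 = 0" if "f \<in> ?A'" for f
    using that linear_on_zero[OF _ UNIV_I] by (auto simp: dual_space_iff[OF A])
  have isoA': "\<forall>x\<in>inA' ` ?A'B. \<forall>y\<in>inA' ` ?A'B. ?F x y = 0"
    unfolding F inA'_def
    by (auto intro!: tensor_map_isotropic[OF V B UB P Q(1) jA'] simp: double_pairing_def lin0)
  have nondeg: "nondegenerate_on ?L ?F"
  proof -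
    obtain c where c: "\<And>b. b = (\<Sum>e\<in>basB. sB (form b (c e)) e)"
      using B.nondegenerate_form_dual_basis[OF Q] by blast
    show ?thesis
      unfolding F
      by (rule tensor_form_nondegenerate[OF V B UB P Q(1) double_pairing_represents[OF assms(3)] UNIV_I UNIV_I c])
  qed
  \<comment> \<open>A common element is orthogonal to both isotropic summands, hence to all of the space.\<close>
  have disj: "inA ` ?AB \<inter> inA' ` ?A'B = {0}"
  proof
    show "inA ` ?AB \<inter> inA' ` ?A'B \<subseteq> {0}"
    proof
      fix u assume u: "u \<in> inA ` ?AB \<inter> inA' ` ?A'B"
      have "?F u (x + y) = 0" if "x \<in> inA ` ?AB" "y \<in> inA' ` ?A'B" for x y
      proof -
        have "u \<in> ?L" "x \<in> ?L" "y \<in> ?L" using u that subs by blast+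
        then have "?F u (x + y) = ?F u x + ?F u y" by (rule Fsimps(3))
        moreover have "?F u x = 0" "?F u y = 0" using u that isoA isoA' by blast+
        ultimately show ?thesis by simp
      qed
      then have "\<forall>t\<in>?L. ?F u t = 0" unfolding sum by blast
      moreover have "u \<in> ?L" using u subs by blast
      ultimately show "u \<in> {0}" using nondeg unfolding nondegenerate_on_def by blast
    qed
    show "{0} \<subseteq> inA ` ?AB \<inter> inA' ` ?A'B"
      using subs fs.subspace_0 by blast
  qed
  have inv: "\<forall>x\<in>?L. \<forall>y\<in>?L. \<forall>z\<in>?L. ?F (?brL x y) z = ?F x (?brL y z)"
    unfolding F
    by (intro ballI tensor_form_invariant[OF AV AB P Psym Q(1,2)] Pinv Qinv)
  note sym = tensor_form_symmetric[OF V B UB P Q(1) Psym Q(2), folded F]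
  have "manin_triple_lie fun_scale ?L ?brL (inA ` ?AB) (inA' ` ?A'B) ?F"
    unfolding manin_triple_lie_def
    by (intro conjI induced_lie_algebra[OF N R] Fbil nondeg sym inv subA subA' sum disj isoA isoA')
  then show ?thesis
    unfolding Let_def inA_def[symmetric] inA'_def[symmetric]
    by (intro conjI embA embA' allI ballI formula)
qed

end
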